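(* Let $k\ge 1$ be an integer. On each non-coarsest level $\ell=1,\dots,L$ of the multigrid hierarchy described in the context, let $B_\ell$ be a symmetric positive definite matrix scaled such that $\rho(B_\ell A_\ell)\le 1$, and let the smoother be the fourth-kind Chebyshev iteration described in the context, so that the smoother iteration matrix is \[ G_\ell = p_k(B_\ell A_\ell), \] where $p_k$ is the scaled and shifted Chebyshev polynomial of the fourth kind, \[ p_k(\lambda)=\frac{1}{2k+1}W_k(1-2\lambda). \] Then \[ \|E_L\|_{A_L}^2 \le \max_{1\le\ell\le L}\frac{C_\ell}{C_\ell+\tfrac43 k(k+1)}, \] where $C_\ell$ is the approximation property constant of level $\ell$ defined in the context.
   Context: Multigrid hierarchy. Levels are indexed $\ell=0,1,\dots,L$ with $L\ge 1$; $\ell=L$ is the finest and $\ell=0$ the coarsest. All matrices are real and $*$ denotes transpose. $A_L$ is a symmetric positive definite (SPD) $n_L\times n_L$ matrix. For $\ell=1,\dots,L$ the prolongation $P_\ell$ is an injective $n_\ell\times n_{\ell-1}$ matrix with $n_{\ell-1}<n_\ell$, and the coarse operators are the Galerkin operators $A_{\ell-1}=P_\ell^*A_\ell P_\ell$. Given smoother iteration matrices $G_\ell$ ($1\le\ell\le L$), the half V-cycle ("coarse-to-fine") is defined recursively: $M_0=A_0^{-1}$, and for $\ell\ge 1$ the matrix $M_\ell$ is determined by \[ E_\ell = I-M_\ell A_\ell = G_\ell K_\ell,\qquad K_\ell = I-P_\ell M_{\ell-1}P_\ell^*A_\ell . \] For an SPD matrix $S$, $\|v\|_S=(v^*Sv)^{1/2}$,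 and $\|T\|_S=\sup_{v\ne0}\|Tv\|_S/\|v\|_S$ for a square matrix $T$. The number $\|E_L\|_{A_L}^2$ is called the V-cycle contraction factor (it is the energy-norm contraction factor of the symmetric V-cycle). $\rho$ denotes the spectral radius. The approximation property constant of level $\ell\ge1$, for the SPD matrix $B_\ell$, is \[ C_\ell = \sup_{\|f\|_{B_\ell}\le 1}\big\|(A_\ell^{-1}-P_\ell A_{\ell-1}^{-1}P_\ell^* )f\big\|_{A_\ell}^2 . \] Chebyshev polynomials of the fourth kind: $W_0(x)=1$, $W_1(x)=2x+1$, $W_n(x)=2xW_{n-1}(x)-W_{n-2}(x)$; equivalently $W_n(\cos\theta)=\sin((n+\tfrac12)\theta)/\sin(\tfrac12\theta)$. Fourth-kind Chebyshev iteration for $Ax=b$ with SPD $A$, $B$ (with $B$ already scaled so that $\rho(BA)\le1$): starting from $x_0$ and $z_0=0$, for $i=1,\dots,k$, \[ z_i=\frac{2i-3}{2i+1}z_{i-1}+\frac{8i-4}{2i+1}B(b-Ax_{i-1}),\qquad x_i=x_{i-1}+z_i ; \] it satisfies $A^{-1}b-x_k=p_k(BA)(A^{-1}b-x_0)$, i.e. its iteration matrix is $p_k(BA)$. *)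

theory Defs
  imports "Jordan_Normal_Form.Spectral_Radius"
begin

definition spd_mat :: "nat \<Rightarrow> real mat \<Rightarrow> bool" where
  "spd_mat n S \<longleftrightarrow> S \<in> carrier_mat n n \<and> S\<^sup>T = S \<and>
     (\<forall>v \<in> carrier_vec n. v \<noteq> 0\<^sub>v n \<longrightarrow> v \<bullet> (S *\<^sub>v v) > 0)"

text \<open>Meaningful for invertible matrices only; the option is \<^const>\<open>None\<close> otherwise.\<close>

definition inv_mat :: "real mat \<Rightarrow> real mat" where
  "inv_mat A = the (mat_inverse A)"

definition real_spectral_radius :: "real mat \<Rightarrow> real" where
  "real_spectral_radius A = spectral_radius (map_mat complex_of_real A)"

definition vec_norm_wrt :: "real mat \<Rightarrow> real vec \<Rightarrow> real" where
  "vec_norm_wrt S v = sqrt (v \<bullet> (S *\<^sub>v v))"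

definition op_norm_wrt :: "real mat \<Rightarrow> real mat \<Rightarrow> real" where
  "op_norm_wrt S T =
     (SUP v \<in> {v \<in> carrier_vec (dim_row S). v \<noteq> 0\<^sub>v (dim_row S)}.
        vec_norm_wrt S (T *\<^sub>v v) / vec_norm_wrt S v)"

definition poly_mat :: "real poly \<Rightarrow> real mat \<Rightarrow> real mat" where
  "poly_mat p X = mat (dim_row X) (dim_row X)
     (\<lambda>(r, c). \<Sum>i\<le>degree p. poly.coeff p i * (X ^\<^sub>m i) $$ (r, c))"

fun cheb4_W :: "nat \<Rightarrow> real poly" where
  "cheb4_W 0 = 1"
| "cheb4_W (Suc 0) = [:1, 2:]"
| "cheb4_W (Suc (Suc n)) = [:0, 2:] * cheb4_W (Suc n) - cheb4_W n"

definition cheb4_p :: "nat \<Rightarrow> real poly" where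
  "cheb4_p k = Polynomial.smult (1 / (2 * real k + 1)) (pcompose (cheb4_W k) [:1, - 2:])"

text \<open>The pair \<open>(x\<^sub>i, z\<^sub>i)\<close> after \<open>i\<close> steps of the fourth-kind Chebyshev iteration for
  \<open>A x = b\<close> with preconditioner \<open>B\<close>, started from \<open>x\<^sub>0\<close> and \<open>z\<^sub>0 = 0\<close>.\<close>

fun cheb4_iter :: "real mat \<Rightarrow> real mat \<Rightarrow> real vec \<Rightarrow> real vec \<Rightarrow> nat \<Rightarrow> real vec \<times> real vec" where
  "cheb4_iter A B b x0 0 = (x0, 0\<^sub>v (dim_row A))"
| "cheb4_iter A B b x0 (Suc j) =
     (let (x, z) = cheb4_iter A B b x0 j;
          i = real (Suc j);
          z' = ((2 * i - 3) / (2 * i + 1)) \<cdot>\<^sub>v z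
               + ((8 * i - 4) / (2 * i + 1)) \<cdot>\<^sub>v (B *\<^sub>v (b - A *\<^sub>v x))
      in (x + z', z'))"

text \<open>\<open>G\<close> is the iteration (error propagation) matrix of \<open>k\<close> steps of that iteration.\<close>

definition cheb4_iteration_matrix :: "nat \<Rightarrow> nat \<Rightarrow> real mat \<Rightarrow> real mat \<Rightarrow> real mat \<Rightarrow> bool" where
  "cheb4_iteration_matrix n k A B G \<longleftrightarrow> G \<in> carrier_mat n n \<and>
     (\<forall>b \<in> carrier_vec n. \<forall>x0 \<in> carrier_vec n.
        inv_mat A *\<^sub>v b - fst (cheb4_iter A B b x0 k) = G *\<^sub>v (inv_mat A *\<^sub>v b - x0))"

text \<open>Arguments: fine operator \<open>A\<close>, coarse operator \<open>Ac\<close>, prolongation \<open>P\<close>, and \<open>B\<close>.\<close>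

definition approx_const :: "real mat \<Rightarrow> real mat \<Rightarrow> real mat \<Rightarrow> real mat \<Rightarrow> real" where
  "approx_const A Ac P B =
     (SUP f \<in> {f \<in> carrier_vec (dim_row A). vec_norm_wrt B f \<le> 1}.
        (vec_norm_wrt A ((inv_mat A - P * inv_mat Ac * P\<^sup>T) *\<^sub>v f))\<^sup>2)"

end

theory Submission
  imports Defs "HOL-Real_Asymp.Real_Asymp"
begin

text \<open>
  Write \<open>\<langle>u, v\<rangle>\<close> for the energy inner product of a level, \<open>C\<close> for its approximation constant and
  \<open>\<gamma> = 4/3 k (k + 1)\<close>. Let \<open>\<delta>\<close> be the maximum of \<open>C / (C + \<gamma>)\<close> over the levels. By induction from the
  coarsest level upwards, the error matrix \<open>T = I - M A\<close> satisfies \<open>\<langle>T u, v\<rangle>\<^sup>2 \<le> \<delta> \<parallel>u\<parallel>\<^sup>2 \<parallel>v\<parallel>\<^sup>2\<close>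
  (\<open>energy_bound\<close>); on the coarsest level \<open>T = 0\<close>.

  In the inductive step \<open>T = G K\<close>, where \<open>G\<close> is a polynomial in \<open>B A\<close> and therefore self-adjoint for the energy inner
  product. Hence \<open>\<langle>T u, v\<rangle> = \<langle>K u, y\<rangle>\<close> with \<open>y = G v\<close>. Split \<open>y\<close> orthogonally into a coarse part in the
  range of the prolongation and a fine part. The coarse correction \<open>K\<close> keeps fine parts and reduces coarse parts by the
  factor \<open>\<surd>\<delta>\<close> of the level below, so that
  \<open>\<langle>K u, y\<rangle>\<^sup>2 \<le> \<parallel>u\<parallel>\<^sup>2 ((1 - \<delta>) \<parallel>fine_part y\<parallel>\<^sup>2 + \<delta> \<parallel>y\<parallel>\<^sup>2)\<close>. The approximation property bounds the fine part by
  \<open>C \<parallel>A y\<parallel>\<^sub>B\<^sup>2 = C \<langle>B A y, y\<rangle>\<close>, and \<open>(1 - \<delta>) C \<le> \<delta> \<gamma>\<close> by the choice of \<open>\<delta>\<close>. The bracket is thus at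
  most \<open>\<delta> (\<parallel>y\<parallel>\<^sup>2 + \<gamma> \<langle>B A y, y\<rangle>)\<close>, and the induction closes (\<open>energy_bound_step\<close>) if this is at most
  \<open>\<delta> \<parallel>v\<parallel>\<^sup>2\<close> (\<open>cheb4_smoothing\<close>).

  In an energy-orthonormal eigenbasis of \<open>B A\<close> (\<open>self_adjoint_spectral\<close>) this last claim is the scalar inequality
  \<open>p\<^sub>k(x)\<^sup>2 (1 + \<gamma> x) \<le> 1\<close> on \<open>[0, 1]\<close> (\<open>cheb4_p_square_weighted_le_1\<close>). With \<open>x = sin\<^sup>2 \<phi>\<close> and \<open>m = 2 k + 1\<close> one has
  \<open>p\<^sub>k(x) = sin (m \<phi>) / (m sin \<phi>)\<close>, and the inequality follows from the monotonicity of \<open>1 / sin\<^sup>2 t - 1 / t\<^sup>2\<close>, whose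
  limit at \<open>0\<close> is \<open>1 / 3\<close>.

  The spectral theorem for matrices that are self-adjoint for an SPD inner product is proved by deflation. As long as the
  deflated matrix is nonzero, it has a nonzero eigenvalue: spectral radius \<open>0\<close> would bound the powers of all its
  multiples, which a nonzero self-adjoint matrix does not permit (\<open>self_adjoint_nonzero_eigenvalue\<close>).
\<close>

section \<open>The weighted square of the fourth-kind Chebyshev polynomial\<close>

lemma sin_ge_cubic:
  fixes t :: real
  assumes "0 \<le> t"
  shows "t - t ^ 3 / 6 \<le> sin t"
proof -
  define f where "f x = sin x - x + x ^ 3 / 6" for x :: real
  have d: "(f has_real_derivative (cos x - 1 + x\<^sup>2 / 2)) (at x)" for x
    unfolding f_def by (auto intro!: derivative_eq_intros)
  have "cos x - 1 + x\<^sup>2 / 2 \<ge> 0" for x :: real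
  proof -
    have "cos x = 1 - 2 * (sin (x / 2))\<^sup>2"
      using cos_double_sin[of "x / 2"] by simp
    moreover have "(sin (x / 2))\<^sup>2 \<le> (x / 2)\<^sup>2"
      using abs_sin_x_le_abs_x[of "x / 2"] by (metis abs_le_square_iff)
    ultimately show ?thesis by (simp add: power_divide)
  qed
  then have "f 0 \<le> f t"
    using d assms by (intro DERIV_nonneg_imp_nondecreasing[of 0 t f]) auto
  then show ?thesis by (simp add: f_def)
qed

lemma cos_le_quartic:
  fixes t :: real
  assumes "0 \<le> t"
  shows "cos t \<le> 1 - t\<^sup>2 / 2 + t ^ 4 / 24"
proof -
  define f where "f x = 1 - x\<^sup>2 / 2 + x ^ 4 / 24 - cos x" for x :: real
  have d: "(f has_real_derivative (sin x - (x - x ^ 3 / 6))) (at x)" for x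
    unfolding f_def by (auto intro!: derivative_eq_intros)
  have "f 0 \<le> f t"
    using d assms sin_ge_cubic by (intro DERIV_nonneg_imp_nondecreasing[of 0 t f]) (auto, smt)
  then show ?thesis by (simp add: f_def)
qed

text \<open>The sign condition behind the monotonicity of \<open>1 / sin\<^sup>2 t - 1 / t\<^sup>2\<close>. Up to \<open>\<pi> / 2\<close> the Taylor bounds
  suffice, because \<open>(1 - t\<^sup>2/6)\<^sup>3\<close> exceeds the bound for the cosine by \<open>t\<^sup>4/24 - t\<^sup>6/216\<close>; beyond, the
  cosine is negative.\<close>

lemma cube_cos_le_sin_cube:
  fixes t :: real
  assumes "0 < t" "t < pi"
  shows "t ^ 3 * cos t \<le> sin t ^ 3"
proof (cases "t \<le> pi / 2")
  case True
  have t2: "t\<^sup>2 \<le> 4"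
    using True assms pi_less_4 power_mono[of t 2 2] by simp
  have "t ^ 3 * cos t \<le> t ^ 3 * (1 - t\<^sup>2 / 2 + t ^ 4 / 24)"
    using cos_le_quartic[of t] assms by (intro mult_left_mono) auto
  also have "1 - t\<^sup>2 / 2 + t ^ 4 / 24 \<le> (1 - t\<^sup>2 / 6) ^ 3"
  proof -
    have "(1 - t\<^sup>2 / 6) ^ 3 - (1 - t\<^sup>2 / 2 + t ^ 4 / 24) = (t\<^sup>2)\<^sup>2 / 24 * (1 - t\<^sup>2 / 9)"
      by (simp add: field_simps power2_eq_square power3_eq_cube power4_eq_xxxx)
    moreover have "\<dots> \<ge> 0" using t2 by simp
    ultimately show ?thesis by linarith
  qed
  then have "t ^ 3 * (1 - t\<^sup>2 / 2 + t ^ 4 / 24) \<le> t ^ 3 * (1 - t\<^sup>2 / 6) ^ 3"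
    using assms by (intro mult_left_mono) auto
  also have "\<dots> = (t - t ^ 3 / 6) ^ 3"
    by (simp add: power_mult_distrib[symmetric] algebra_simps power2_eq_square power3_eq_cube)
  also have "\<dots> \<le> sin t ^ 3"
  proof (rule power_mono[OF sin_ge_cubic])
    have "t - t ^ 3 / 6 = t * (1 - t\<^sup>2 / 6)" by (simp add: algebra_simps power2_eq_square power3_eq_cube)
    moreover have "\<dots> \<ge> 0" using t2 assms by simp
    ultimately show "0 \<le> t - t ^ 3 / 6" by simp
  qed (use assms in simp)
  finally show ?thesis .
next
  case False
  have "cos t \<le> 0"
    using False assms cos_monotone_0_pi_le[of "pi / 2" t] by simp
  moreover have "0 < sin t" using assms by (rule sin_gt_zero)
  ultimately show ?thesis
    using assms by (meson mult_nonneg_nonpos order_trans zero_le_power less_imp_le)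
qed

lemma inverse_sin_square_minus_inverse_square_mono:
  fixes s t :: real
  assumes "0 < s" "s \<le> t" "t < pi"
  shows "1 / (sin s)\<^sup>2 - 1 / s\<^sup>2 \<le> 1 / (sin t)\<^sup>2 - 1 / t\<^sup>2"
proof -
  define h where "h x = 1 / (sin x)\<^sup>2 - 1 / x\<^sup>2" for x :: real
  have "h s \<le> h t"
  proof (rule DERIV_nonneg_imp_nondecreasing[OF assms(2)])
    fix x assume "s \<le> x" "x \<le> t"
    then have x: "0 < x" "x < pi" using assms by auto
    then have sx: "0 < sin x" by (simp add: sin_gt_zero)
    have "(h has_real_derivative (2 * (sin x ^ 3 - x ^ 3 * cos x) / (x ^ 3 * sin x ^ 3))) (at x)"
      unfolding h_def using x sx
      by (auto intro!: derivative_eq_intros simp: field_simps power2_eq_square power3_eq_cube)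
    moreover have "2 * (sin x ^ 3 - x ^ 3 * cos x) / (x ^ 3 * sin x ^ 3) \<ge> 0"
      using cube_cos_le_sin_cube[OF x] x sx by simp
    ultimately show "\<exists>y. (h has_real_derivative y) (at x) \<and> 0 \<le> y" by blast
  qed
  then show ?thesis by (simp add: h_def)
qed

text \<open>The value \<open>1 / 3\<close> is the limit at \<open>0\<close> of the increasing function on the left.\<close>

lemma inverse_sin_square_ge:
  fixes t :: real
  assumes "0 < t" "t < pi"
  shows "1 / (sin t)\<^sup>2 - 1 / t\<^sup>2 \<ge> 1 / 3"
proof (rule tendsto_upperbound)
  show "((\<lambda>s::real. 1 / (sin s)\<^sup>2 - 1 / s\<^sup>2) \<longlongrightarrow> 1 / 3) (at_right 0)"
    by real_asymp
  have "eventually (\<lambda>s::real. s \<in> {0<..<t}) (at_right 0)"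
    using assms eventually_at_right_real by blast
  then show "\<forall>\<^sub>F s in at_right 0. 1 / (sin s)\<^sup>2 - 1 / s\<^sup>2 \<le> 1 / (sin t)\<^sup>2 - 1 / t\<^sup>2"
    by (rule eventually_mono) (use assms inverse_sin_square_minus_inverse_square_mono in auto)
qed simp

text \<open>Put \<open>h t = 1 / sin\<^sup>2 t - 1 / t\<^sup>2\<close>. Divided by \<open>sin\<^sup>2 \<phi> sin\<^sup>2 (m \<phi>)\<close>, the claim becomes
  \<open>m\<^sup>2 h (m \<phi>) \<ge> h \<phi> + (m\<^sup>2 - 1) / 3\<close>: the terms \<open>1 / \<phi>\<^sup>2\<close> cancel, which is why \<open>h\<close> is the right function.
  While \<open>m \<phi> < \<pi>\<close>, this follows from \<open>h (m \<phi>) \<ge> h \<phi> \<ge> 1 / 3\<close>. For larger \<open>m \<phi>\<close> the sine is already so large that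
  the crude bound \<open>sin\<^sup>2 (m \<phi>) \<le> 1\<close> is enough.\<close>

lemma sin_multiple_bound:
  fixes \<phi> m :: real
  assumes "0 < \<phi>" "\<phi> \<le> pi / 2" "1 \<le> m"
  shows "(sin (m * \<phi>))\<^sup>2 * (1 + (m\<^sup>2 - 1) / 3 * (sin \<phi>)\<^sup>2) \<le> m\<^sup>2 * (sin \<phi>)\<^sup>2"
proof -
  have s: "0 < sin \<phi>" using assms pi_gt_zero by (intro sin_gt_zero) linarith+
  have m2: "1 \<le> m\<^sup>2" using assms by simp
  show ?thesis
  proof (cases "m * \<phi> < pi")
    case True
    define h where "h t = 1 / (sin t)\<^sup>2 - 1 / t\<^sup>2" for t :: real
    have m\<phi>: "0 < m * \<phi>" "\<phi> \<le> m * \<phi>" using assms by auto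
    have S: "0 < sin (m * \<phi>)" using True m\<phi> by (simp add: sin_gt_zero)
    have "h \<phi> \<le> h (m * \<phi>)" and "1 / 3 \<le> h \<phi>"
      using inverse_sin_square_minus_inverse_square_mono[of \<phi> "m * \<phi>"]
        inverse_sin_square_ge[of \<phi>] assms m\<phi> True unfolding h_def by auto
    then have "m\<^sup>2 * h (m * \<phi>) \<ge> h \<phi> + (m\<^sup>2 - 1) / 3"
      using m2 mult_left_mono[of "h \<phi>" "h (m * \<phi>)" "m\<^sup>2"] mult_left_mono[of "1 / 3" "h \<phi>" "m\<^sup>2 - 1"]
      by (simp add: algebra_simps diff_divide_distrib)
    then have *: "1 / (sin \<phi>)\<^sup>2 + (m\<^sup>2 - 1) / 3 \<le> m\<^sup>2 / (sin (m * \<phi>))\<^sup>2"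
      using assms by (simp add: h_def power_mult_distrib algebra_simps)
    have "(sin (m * \<phi>))\<^sup>2 * (1 + (m\<^sup>2 - 1) / 3 * (sin \<phi>)\<^sup>2)
        = ((sin (m * \<phi>))\<^sup>2 * (sin \<phi>)\<^sup>2) * (1 / (sin \<phi>)\<^sup>2 + (m\<^sup>2 - 1) / 3)"
      using s by (simp add: field_simps)
    also have "\<dots> \<le> ((sin (m * \<phi>))\<^sup>2 * (sin \<phi>)\<^sup>2) * (m\<^sup>2 / (sin (m * \<phi>))\<^sup>2)"
      by (rule mult_left_mono[OF *]) simp
    finally show ?thesis using S by (simp add: mult.commute)
  next
    case False
    \<comment> \<open>It suffices that \<open>m\<^sup>2 sin\<^sup>2 \<phi> \<ge> 3 / 2\<close>. This follows from \<open>sin \<phi> \<ge> \<phi> / 2\<close> and \<open>\<pi>\<^sup>2 \<ge> 6\<close>, both of which the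
      cubic bound for the sine provides.\<close>
    have "\<not> sqrt 3 < \<phi>"
    proof
      assume *: "sqrt 3 < \<phi>"
      have "cos (sqrt 3) \<le> 1 - 3 / 2 + 9 / 24"
        using cos_le_quartic[of "sqrt 3"] by (simp add: power4_eq_xxxx)
      moreover have "0 \<le> cos \<phi>" using assms by (intro cos_ge_zero) auto
      moreover have "cos \<phi> \<le> cos (sqrt 3)"
        using * assms by (intro cos_monotone_0_pi_le) auto
      ultimately show False by simp
    qed
    then have p2: "\<phi>\<^sup>2 \<le> 3"
      using assms power_mono[of \<phi> "sqrt 3" 2] by simp
    have "pi * 6 \<le> pi * pi\<^sup>2"
      using sin_ge_cubic[of pi] by (simp add: power2_eq_square power3_eq_cube)
    then have pi2: "6 \<le> pi\<^sup>2" by simp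
    have "sin \<phi> \<ge> \<phi> / 2"
    proof -
      have "\<phi> - \<phi> ^ 3 / 6 = \<phi> * (1 - \<phi>\<^sup>2 / 6)" by (simp add: algebra_simps power2_eq_square power3_eq_cube)
      also have "\<dots> \<ge> \<phi> * (1 / 2)" using p2 assms by (intro mult_left_mono) auto
      finally show ?thesis using sin_ge_cubic[of \<phi>] assms by simp
    qed
    then have "m * sin \<phi> \<ge> m * (\<phi> / 2)" using assms by (intro mult_left_mono) auto
    then have "pi / 2 \<le> m * sin \<phi>" using False by simp
    then have "(pi / 2)\<^sup>2 \<le> (m * sin \<phi>)\<^sup>2" by (intro power_mono) auto
    then have "3 / 2 \<le> m\<^sup>2 * (sin \<phi>)\<^sup>2"
      using pi2 by (simp add: power_mult_distrib power_divide)
    moreover have "0 \<le> (sin \<phi>)\<^sup>2" by simp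
    moreover have "(m\<^sup>2 - 1) / 3 * (sin \<phi>)\<^sup>2 = m\<^sup>2 * (sin \<phi>)\<^sup>2 / 3 - (sin \<phi>)\<^sup>2 / 3"
      by (simp add: algebra_simps diff_divide_distrib)
    ultimately have *: "1 + (m\<^sup>2 - 1) / 3 * (sin \<phi>)\<^sup>2 \<le> m\<^sup>2 * (sin \<phi>)\<^sup>2" by linarith
    have "(sin (m * \<phi>))\<^sup>2 * (1 + (m\<^sup>2 - 1) / 3 * (sin \<phi>)\<^sup>2) \<le> 1 * (1 + (m\<^sup>2 - 1) / 3 * (sin \<phi>)\<^sup>2)"
      using m2 by (intro mult_right_mono) (auto simp: abs_square_le_1)
    with * show ?thesis by (simp only: mult_1_left)
  qed
qed

text \<open>The trigonometric form of the fourth-kind polynomials, with \<open>\<phi>\<close> half the usual angle, so that the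
  argument \<open>cos (2 \<phi>) = 1 - 2 sin\<^sup>2 \<phi>\<close> corresponds to the eigenvalue \<open>sin\<^sup>2 \<phi> \<in> [0, 1]\<close>.\<close>

lemma cheb4_W_sin:
  "sin \<phi> * poly (cheb4_W k) (1 - 2 * (sin \<phi>)\<^sup>2) = sin ((2 * real k + 1) * \<phi>)"
proof (induction k rule: cheb4_W.induct)
  case 1
  show ?case by simp
next
  case 2
  have "sin (3 * \<phi>) = sin (2 * \<phi> + \<phi>)" by simp
  also have "\<dots> = 2 * sin \<phi> * (cos \<phi>)\<^sup>2 + (1 - 2 * (sin \<phi>)\<^sup>2) * sin \<phi>"
    unfolding sin_add sin_double cos_double_sin by (simp add: power2_eq_square)
  finally show ?case by (simp add: cos_squared_eq algebra_simps)
next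
  case (3 k)
  let ?c = "1 - 2 * (sin \<phi>)\<^sup>2"
  let ?\<theta> = "(2 * real (Suc k) + 1) * \<phi>"
  have c: "?c = cos (2 * \<phi>)" by (simp add: cos_double_sin)
  have "sin \<phi> * poly (cheb4_W (Suc (Suc k))) ?c = 2 * ?c * sin ?\<theta> - sin ((2 * real k + 1) * \<phi>)"
    unfolding 3[symmetric] by (simp add: algebra_simps)
  also have "\<dots> = 2 * cos (2 * \<phi>) * sin ?\<theta> - sin (?\<theta> - 2 * \<phi>)"
    unfolding c by (simp add: algebra_simps)
  also have "\<dots> = sin (?\<theta> + 2 * \<phi>)"
    unfolding sin_add sin_diff by simp
  also have "?\<theta> + 2 * \<phi> = (2 * real (Suc (Suc k)) + 1) * \<phi>" by (simp add: algebra_simps)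
  finally show ?case .
qed

lemma cheb4_W_at_1: "poly (cheb4_W k) 1 = 2 * real k + 1"
  by (induction k rule: cheb4_W.induct) auto

lemma poly_cheb4_p: "poly (cheb4_p k) x = poly (cheb4_W k) (1 - 2 * x) / (2 * real k + 1)"
  by (simp add: cheb4_p_def poly_pcompose mult.commute)

text \<open>The scalar inequality that determines the constant \<open>4/3 k (k + 1)\<close>: it is minus twice the derivative of the
  polynomial at \<open>0\<close>, so that a larger weight would violate the inequality to first order at \<open>x = 0\<close>. With
  \<open>m = 2 k + 1\<close> the weight equals \<open>(m\<^sup>2 - 1) / 3\<close>.\<close>

theorem cheb4_p_square_weighted_le_1:
  assumes "0 \<le> x" "x \<le> 1"
  shows "(poly (cheb4_p k) x)\<^sup>2 * (1 + 4 / 3 * real k * (real k + 1) * x) \<le> 1"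
proof (cases "x = 0")
  case True
  have "2 * real k + 1 \<noteq> 0" by linarith
  then show ?thesis using True by (simp add: poly_cheb4_p cheb4_W_at_1)
next
  case False
  define \<phi> where "\<phi> = arcsin (sqrt x)"
  have sx: "0 < sqrt x" "sqrt x \<le> 1" "- 1 \<le> sqrt x"
    using assms False by (auto intro: order_trans[of _ 0])
  have sin: "sin \<phi> = sqrt x" unfolding \<phi>_def using sx by (intro sin_arcsin) auto
  have \<phi>: "0 < \<phi>" "\<phi> \<le> pi / 2"
    unfolding \<phi>_def using sx arcsin_less_mono[of 0 "sqrt x"] arcsin_bounded[of "sqrt x"] by auto
  define m where "m = 2 * real k + 1"
  have m: "1 \<le> m" by (simp add: m_def)
  have x: "x = (sin \<phi>)\<^sup>2" using assms by (simp add: sin)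
  have p: "poly (cheb4_p k) x = sin (m * \<phi>) / (m * sin \<phi>)"
    using cheb4_W_sin[of \<phi> k] sx sin m unfolding x poly_cheb4_p m_def[symmetric]
    by (simp add: field_simps)
  have c: "4 / 3 * real k * (real k + 1) = (m\<^sup>2 - 1) / 3"
    by (simp add: m_def field_simps power2_eq_square)
  have "0 < (m * sin \<phi>)\<^sup>2" using m sx sin by simp
  then show ?thesis
    using sin_multiple_bound[OF \<phi> m]
    unfolding p c by (simp add: x power_divide power_mult_distrib divide_le_eq)
qed

section \<open>Inner products of SPD matrices and eigenvalues of self-adjoint matrices\<close>

definition form :: "real mat \<Rightarrow> real vec \<Rightarrow> real vec \<Rightarrow> real" where
  "form S u v = u \<bullet> (S *\<^sub>v v)"

lemma spd_carrier: "spd_mat n S \<Longrightarrow> S \<in> carrier_mat n n"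
  by (simp add: spd_mat_def)

lemma form_add_left:
  assumes "S \<in> carrier_mat n n" "u \<in> carrier_vec n" "v \<in> carrier_vec n" "w \<in> carrier_vec n"
  shows "form S (u + v) w = form S u w + form S v w"
  unfolding form_def using assms by (intro add_scalar_prod_distrib) auto

lemma form_add_right:
  assumes "S \<in> carrier_mat n n" "u \<in> carrier_vec n" "v \<in> carrier_vec n" "w \<in> carrier_vec n"
  shows "form S u (v + w) = form S u v + form S u w"
  unfolding form_def using assms
  by (simp add: mult_add_distrib_mat_vec[of S n n] scalar_prod_add_distrib[of _ n])

lemma form_minus_left:
  assumes "S \<in> carrier_mat n n" "u \<in> carrier_vec n" "v \<in> carrier_vec n" "w \<in> carrier_vec n"
  shows "form S (u - v) w = form S u w - form S v w"
  unfolding form_def using assms by (intro minus_scalar_prod_distrib) auto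

lemma form_minus_right:
  assumes "S \<in> carrier_mat n n" "u \<in> carrier_vec n" "v \<in> carrier_vec n" "w \<in> carrier_vec n"
  shows "form S u (v - w) = form S u v - form S u w"
  unfolding form_def using assms
  by (simp add: mult_minus_distrib_mat_vec[of S n n] scalar_prod_minus_distrib[of _ n])

lemma form_smult_left:
  assumes "S \<in> carrier_mat n n" "u \<in> carrier_vec n" "v \<in> carrier_vec n"
  shows "form S (c \<cdot>\<^sub>v u) v = c * form S u v"
  unfolding form_def using assms by simp

lemma form_smult_right:
  assumes "S \<in> carrier_mat n n" "u \<in> carrier_vec n" "v \<in> carrier_vec n"
  shows "form S u (c \<cdot>\<^sub>v v) = c * form S u v"
  unfolding form_def using assms by (simp add: mult_mat_vec[of S n n])

lemma form_zero:
  assumes "S \<in> carrier_mat n n" "u \<in> carrier_vec n"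
  shows "form S (0\<^sub>v n) u = 0" "form S u (0\<^sub>v n) = 0"
proof -
  have "u - u = 0\<^sub>v n" using assms by auto
  then show "form S (0\<^sub>v n) u = 0" "form S u (0\<^sub>v n) = 0"
    using form_minus_left[of S n u u u] form_minus_right[of S n u u u] assms by auto
qed

lemmas form_linear = form_add_left form_add_right form_minus_left form_minus_right
  form_smult_left form_smult_right form_zero

lemma form_commute:
  assumes "spd_mat n S" "u \<in> carrier_vec n" "v \<in> carrier_vec n"
  shows "form S u v = form S v u"
proof -
  have S: "S \<in> carrier_mat n n" "S\<^sup>T = S" using assms by (auto simp: spd_mat_def)
  have "form S u v = (S *\<^sub>v u) \<bullet> v"
    using transpose_vec_mult_scalar[OF S(1) assms(3,2)] S by (simp add: form_def)
  also have "\<dots> = form S v u"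
    using S assms by (auto simp: form_def intro!: comm_scalar_prod[of _ n])
  finally show ?thesis .
qed

lemma form_pos:
  assumes "spd_mat n S" "v \<in> carrier_vec n" "v \<noteq> 0\<^sub>v n"
  shows "0 < form S v v"
  using assms by (simp add: spd_mat_def form_def)

lemma form_nonneg:
  assumes "spd_mat n S" "v \<in> carrier_vec n"
  shows "0 \<le> form S v v"
  using form_pos[OF assms] form_zero[OF spd_carrier[OF assms(1)] assms(2)]
  by (cases "v = 0\<^sub>v n") auto

lemma form_Cauchy_Schwarz:
  assumes "spd_mat n S" "u \<in> carrier_vec n" "v \<in> carrier_vec n"
  shows "(form S u v)\<^sup>2 \<le> form S u u * form S v v"
proof (cases "v = 0\<^sub>v n")
  case True
  then show ?thesis using form_zero[OF spd_carrier[OF assms(1)]] assms by auto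
next
  case False
  note S = spd_carrier[OF assms(1)]
  let ?a = "form S v v" and ?b = "form S u v"
  have a: "0 < ?a" using form_pos[OF assms(1,3) False] .
  have "0 \<le> form S (?a \<cdot>\<^sub>v u - ?b \<cdot>\<^sub>v v) (?a \<cdot>\<^sub>v u - ?b \<cdot>\<^sub>v v)"
    using assms by (intro form_nonneg[of n]) auto
  also have "\<dots> = ?a * (form S u u * ?a - ?b\<^sup>2)"
    using S assms form_commute[OF assms]
    by (simp add: form_linear[of S n] algebra_simps power2_eq_square)
  finally show ?thesis using a by (simp add: zero_le_mult_iff)
qed

definition self_adjoint :: "nat \<Rightarrow> real mat \<Rightarrow> real mat \<Rightarrow> bool" where
  "self_adjoint n S X \<longleftrightarrow> X \<in> carrier_mat n n \<and>
     (\<forall>u \<in> carrier_vec n. \<forall>v \<in> carrier_vec n. form S (X *\<^sub>v u) v = form S u (X *\<^sub>v v))"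

lemma self_adjointD:
  assumes "self_adjoint n S X"
  shows "X \<in> carrier_mat n n"
    and "u \<in> carrier_vec n \<Longrightarrow> v \<in> carrier_vec n \<Longrightarrow> form S (X *\<^sub>v u) v = form S u (X *\<^sub>v v)"
  using assms by (auto simp: self_adjoint_def)

lemma smult_mat_mult_vec:
  fixes X :: "real mat"
  assumes "X \<in> carrier_mat n n" "v \<in> carrier_vec n"
  shows "(c \<cdot>\<^sub>m X) *\<^sub>v v = c \<cdot>\<^sub>v (X *\<^sub>v v)"
  using assms by (intro eq_vecI) auto

lemma self_adjoint_smult:
  assumes "self_adjoint n S X" "S \<in> carrier_mat n n"
  shows "self_adjoint n S (c \<cdot>\<^sub>m X)"
  using self_adjointD[OF assms(1)] assms(2) unfolding self_adjoint_def
  by (auto simp: smult_mat_mult_vec[of _ n] form_linear[of S n])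

text \<open>Writing an eigenvector as \<open>a + \<i> b\<close> gives \<open>X a = Re \<mu> a - Im \<mu> b\<close> and \<open>X b = Im \<mu> a + Re \<mu> b\<close>. Comparing
  \<open>\<langle>X a, b\<rangle>\<close> with \<open>\<langle>a, X b\<rangle>\<close> leaves \<open>Im \<mu> (\<parallel>a\<parallel>\<^sup>2 + \<parallel>b\<parallel>\<^sup>2) = 0\<close>; afterwards \<open>a\<close> and \<open>b\<close> solve the real
  eigenvalue equation and one of them is nonzero.\<close>

lemma self_adjoint_complex_eigenvalue:
  assumes S: "spd_mat n S" and X: "self_adjoint n S X"
    and ev: "eigenvalue (map_mat complex_of_real X) \<mu>"
  shows "\<exists>w \<in> carrier_vec n. w \<noteq> 0\<^sub>v n \<and> X *\<^sub>v w = Re \<mu> \<cdot>\<^sub>v w" and "Im \<mu> = 0"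
proof -
  note Xc = self_adjointD(1)[OF X] and Sc = spd_carrier[OF S]
  obtain z where z: "z \<in> carrier_vec n" "z \<noteq> 0\<^sub>v n"
    and zev: "map_mat complex_of_real X *\<^sub>v z = \<mu> \<cdot>\<^sub>v z"
    using ev Xc by (auto simp: eigenvalue_def eigenvector_def)
  define a b where "a = map_vec Re z" and "b = map_vec Im z"
  have ab: "a \<in> carrier_vec n" "b \<in> carrier_vec n" using z by (auto simp: a_def b_def)
  have comp: "(\<Sum>j = 0..<n. complex_of_real (X $$ (i, j)) * z $ j) = \<mu> * z $ i" if "i < n" for i
    using arg_cong[OF zev, of "\<lambda>v. v $ i"] that z Xc by (simp add: scalar_prod_def)
  have Xa: "X *\<^sub>v a = Re \<mu> \<cdot>\<^sub>v a - Im \<mu> \<cdot>\<^sub>v b"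
  proof (rule eq_vecI)
    fix i assume "i < dim_vec (Re \<mu> \<cdot>\<^sub>v a - Im \<mu> \<cdot>\<^sub>v b)"
    then have i: "i < n" using ab by auto
    show "(X *\<^sub>v a) $ i = (Re \<mu> \<cdot>\<^sub>v a - Im \<mu> \<cdot>\<^sub>v b) $ i"
      using arg_cong[OF comp[OF i], of Re] i z Xc by (simp add: scalar_prod_def a_def b_def Re_sum)
  qed (use ab Xc in auto)
  have Xb: "X *\<^sub>v b = Im \<mu> \<cdot>\<^sub>v a + Re \<mu> \<cdot>\<^sub>v b"
  proof (rule eq_vecI)
    fix i assume "i < dim_vec (Im \<mu> \<cdot>\<^sub>v a + Re \<mu> \<cdot>\<^sub>v b)"
    then have i: "i < n" using ab by auto
    show "(X *\<^sub>v b) $ i = (Im \<mu> \<cdot>\<^sub>v a + Re \<mu> \<cdot>\<^sub>v b) $ i"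
      using arg_cong[OF comp[OF i], of Im] i z Xc
      by (simp add: scalar_prod_def a_def b_def Im_sum algebra_simps)
  qed (use ab Xc in auto)
  have nz: "a \<noteq> 0\<^sub>v n \<or> b \<noteq> 0\<^sub>v n"
  proof (rule ccontr)
    assume "\<not> ?thesis"
    then have "Re (z $ i) = 0" "Im (z $ i) = 0" if "i < n" for i
      using that z unfolding a_def b_def by (auto simp: vec_eq_iff)
    then have "z = 0\<^sub>v n" using z by (intro eq_vecI) (auto simp: complex_eq_iff)
    with z show False by simp
  qed
  have pos: "0 < form S a a + form S b b"
    using nz form_pos[OF S, of a] form_pos[OF S, of b] form_nonneg[OF S, of a] form_nonneg[OF S, of b] ab
    by (auto intro: add_pos_nonneg add_nonneg_pos)
  have "form S (X *\<^sub>v a) b = form S a (X *\<^sub>v b)" using self_adjointD(2)[OF X ab] .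
  then have "Im \<mu> * (form S a a + form S b b) = 0"
    unfolding Xa Xb using ab Sc by (simp add: form_linear[of S n] algebra_simps)
  with pos show Im0: "Im \<mu> = 0" by simp
  have "X *\<^sub>v a = Re \<mu> \<cdot>\<^sub>v a" "X *\<^sub>v b = Re \<mu> \<cdot>\<^sub>v b"
    unfolding Xa Xb Im0 using ab by auto
  with nz ab show "\<exists>w \<in> carrier_vec n. w \<noteq> 0\<^sub>v n \<and> X *\<^sub>v w = Re \<mu> \<cdot>\<^sub>v w" by blast
qed

lemma pow_mat_funpow:
  fixes X :: "real mat"
  assumes "X \<in> carrier_mat n n" "v \<in> carrier_vec n"
  shows "(X ^\<^sub>m k) *\<^sub>v v = ((*\<^sub>v) X ^^ k) v"
  using assms(2)
proof (induction k arbitrary: v)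
  case (Suc k)
  have "(X ^\<^sub>m Suc k) *\<^sub>v v = X ^\<^sub>m k *\<^sub>v (X *\<^sub>v v)"
    using assms(1) Suc.prems by (simp add: assoc_mult_mat_vec[of _ n n _ n])
  also have "\<dots> = ((*\<^sub>v) X ^^ Suc k) v"
    using Suc.IH[of "X *\<^sub>v v"] assms(1) Suc.prems by (simp add: funpow_swap1)
  finally show ?case .
qed (use assms(1) in simp)

lemma funpow_mult_carrier:
  fixes X :: "real mat"
  assumes "X \<in> carrier_mat n n" "v \<in> carrier_vec n"
  shows "((*\<^sub>v) X ^^ k) v \<in> carrier_vec n"
  by (induction k) (use assms in auto)

lemma self_adjoint_funpow:
  assumes X: "self_adjoint n S X" and uv: "u \<in> carrier_vec n" "v \<in> carrier_vec n"
  shows "form S (((*\<^sub>v) X ^^ k) u) v = form S u (((*\<^sub>v) X ^^ k) v)"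
  using uv(2)
proof (induction k arbitrary: v)
  case (Suc k)
  note Xc = self_adjointD(1)[OF X]
  have "form S (((*\<^sub>v) X ^^ Suc k) u) v = form S (((*\<^sub>v) X ^^ k) u) (X *\<^sub>v v)"
    using self_adjointD(2)[OF X funpow_mult_carrier[OF Xc uv(1)] Suc.prems] by simp
  also have "\<dots> = form S u (((*\<^sub>v) X ^^ Suc k) v)"
    using Suc.IH[of "X *\<^sub>v v"] Xc Suc.prems by (simp add: funpow_swap1)
  finally show ?case .
qed simp

text \<open>For a self-adjoint \<open>X\<close> the sequence \<open>g k = \<parallel>X\<^sup>k v\<parallel>\<^sup>2\<close> is log-convex by Cauchy-Schwarz. So if it doubled in its
  first step, it would at least double in every step, against the boundedness of the powers.\<close>

lemma power_bounded_imp_energy_less_double: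
  assumes S: "spd_mat n S" and X: "self_adjoint n S X" and v: "v \<in> carrier_vec n"
    and bnd: "\<And>k i j. i < n \<Longrightarrow> j < n \<Longrightarrow> \<bar>(X ^\<^sub>m k) $$ (i, j)\<bar> \<le> c"
  shows "form S (X *\<^sub>v v) (X *\<^sub>v v) < 2 * form S v v \<or> v = 0\<^sub>v n"
proof (rule ccontr)
  assume neg: "\<not> ?thesis"
  note Xc = self_adjointD(1)[OF X] and Sc = spd_carrier[OF S]
  define x where "x k = ((*\<^sub>v) X ^^ k) v" for k
  define g where "g k = form S (x k) (x k)" for k
  have xc: "x k \<in> carrier_vec n" for k
    unfolding x_def using funpow_mult_carrier[OF Xc v] .
  have x_Suc: "x (Suc k) = X *\<^sub>v x k" for k by (simp add: x_def)
  have g0: "0 < g 0" using neg form_pos[OF S v] by (simp add: g_def x_def)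
  have log_convex: "(g (Suc k))\<^sup>2 \<le> g k * g (Suc (Suc k))" for k
  proof -
    have "g (Suc k) = form S (x k) (x (Suc (Suc k)))"
      using self_adjointD(2)[OF X xc[of k] xc[of "Suc k"]] by (simp add: g_def x_Suc)
    then show ?thesis
      using form_Cauchy_Schwarz[OF S xc[of k] xc[of "Suc (Suc k)"]] by (simp add: g_def)
  qed
  have step: "0 < g k \<and> 2 * g k \<le> g (Suc k)" for k
  proof (induction k)
    case 0
    then show ?case using g0 neg by (simp add: g_def x_def)
  next
    case (Suc k)
    let ?a = "g k" and ?b = "g (Suc k)" and ?c = "g (Suc (Suc k))"
    have b: "0 < ?b" using Suc by linarith
    have "0 \<le> ?c" unfolding g_def by (rule form_nonneg[OF S xc])
    then have "2 * ?a * ?c \<le> ?b * ?c" using Suc by (intro mult_right_mono) auto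
    then have "?b * (2 * ?b) \<le> ?b * ?c"
      using log_convex[of k] by (simp add: power2_eq_square)
    then show ?case using b by simp
  qed
  have growth: "2 ^ k * g 0 \<le> g k" for k
  proof (induction k)
    case (Suc k)
    then show ?case using step[of k] by simp
  qed simp
  define w where "w = S *\<^sub>v v"
  have wc: "w \<in> carrier_vec n" using Sc v by (simp add: w_def)
  define D where "D = (\<Sum>i = 0..<n. \<Sum>j = 0..<n. \<bar>w $ i\<bar> * (c * \<bar>v $ j\<bar>))"
  have bounded: "g k \<le> D" for k
  proof -
    have "g k = form S (((*\<^sub>v) X ^^ (k + k)) v) v"
      using self_adjoint_funpow[OF X xc[of k] v, of k] form_commute[OF S xc[of k]] xc[of "k + k"] v
      unfolding g_def x_def by (simp add: funpow_add)
    also have "\<dots> = form S v ((X ^\<^sub>m (k + k)) *\<^sub>v v)"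
      using form_commute[OF S v xc[of "k + k"]] pow_mat_funpow[OF Xc v] by (simp add: x_def)
    also have "\<dots> = form S ((X ^\<^sub>m (k + k)) *\<^sub>v v) v"
      using form_commute[OF S v] Xc v by (metis mult_mat_vec_carrier pow_carrier_mat)
    also have "\<dots> = (\<Sum>i = 0..<n. \<Sum>j = 0..<n. w $ i * ((X ^\<^sub>m (k + k)) $$ (i, j) * v $ j))"
      unfolding form_def w_def[symmetric] using Xc v wc
      by (simp add: scalar_prod_def sum_distrib_left sum_distrib_right mult_ac)
    also have "\<dots> \<le> D"
      unfolding D_def
    proof (intro sum_mono)
      fix i j assume "i \<in> {0..<n}" "j \<in> {0..<n}"
      then have "\<bar>w $ i\<bar> * (\<bar>(X ^\<^sub>m (k + k)) $$ (i, j)\<bar> * \<bar>v $ j\<bar>) \<le> \<bar>w $ i\<bar> * (c * \<bar>v $ j\<bar>)"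
        using bnd by (intro mult_left_mono mult_right_mono) auto
      then show "w $ i * ((X ^\<^sub>m (k + k)) $$ (i, j) * v $ j) \<le> \<bar>w $ i\<bar> * (c * \<bar>v $ j\<bar>)"
        by (metis abs_ge_self abs_mult order_trans)
    qed
    finally show ?thesis .
  qed
  obtain k where "D / g 0 < 2 ^ k" using real_arch_pow[of 2 "D / g 0"] by auto
  then have "D < 2 ^ k * g 0" using g0 by (simp add: divide_less_eq)
  with growth[of k] bounded[of k] show False by linarith
qed

text \<open>Suppose that \<open>X v \<noteq> 0\<close> but all eigenvalues vanish. Then every multiple of \<open>X\<close> has spectral radius \<open>0\<close>
  and hence bounded powers. Scaling \<open>X\<close> such that it exactly doubles \<open>\<parallel>v\<parallel>\<^sup>2\<close> contradicts the preceding lemma.\<close>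

lemma self_adjoint_nonzero_eigenvalue:
  assumes S: "spd_mat n S" and X: "self_adjoint n S X"
    and v: "v \<in> carrier_vec n" and Xv: "X *\<^sub>v v \<noteq> 0\<^sub>v n"
  shows "\<exists>\<mu> w. \<mu> \<noteq> 0 \<and> w \<in> carrier_vec n \<and> w \<noteq> 0\<^sub>v n \<and> X *\<^sub>v w = \<mu> \<cdot>\<^sub>v w"
proof (rule ccontr)
  assume no_ev: "\<not> ?thesis"
  note Xc = self_adjointD(1)[OF X] and Sc = spd_carrier[OF S]
  have Xvc: "X *\<^sub>v v \<in> carrier_vec n" using Xc v by simp
  have v0: "v \<noteq> 0\<^sub>v n" using Xv Xc by auto
  have n: "0 < n" using v v0 by (cases n) auto
  define q where "q = 2 * form S v v / form S (X *\<^sub>v v) (X *\<^sub>v v)"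
  have q: "0 < q" unfolding q_def using form_pos[OF S v v0] form_pos[OF S Xvc Xv] by simp
  define Z where "Z = sqrt q \<cdot>\<^sub>m X"
  have Z: "self_adjoint n S Z" unfolding Z_def by (rule self_adjoint_smult[OF X Sc])
  note Zc = self_adjointD(1)[OF Z]
  let ?Z = "map_mat complex_of_real Z"
  have ev0: "\<mu> = 0" if ev: "eigenvalue ?Z \<mu>" for \<mu>
  proof -
    obtain w where w: "w \<in> carrier_vec n" "w \<noteq> 0\<^sub>v n" "Z *\<^sub>v w = Re \<mu> \<cdot>\<^sub>v w"
      using self_adjoint_complex_eigenvalue(1)[OF S Z ev] by blast
    have "X *\<^sub>v w = (1 / sqrt q * sqrt q) \<cdot>\<^sub>v (X *\<^sub>v w)" using q by simp
    also have "\<dots> = (1 / sqrt q) \<cdot>\<^sub>v (Z *\<^sub>v w)"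
      unfolding Z_def using smult_mat_mult_vec[OF Xc w(1)] by (simp add: smult_smult_assoc)
    also have "\<dots> = (Re \<mu> / sqrt q) \<cdot>\<^sub>v w" by (simp add: w(3) smult_smult_assoc)
    finally have "Re \<mu> / sqrt q = 0" using no_ev w by blast
    then have "Re \<mu> = 0" using q by simp
    with self_adjoint_complex_eigenvalue(2)[OF S Z ev] show ?thesis by (simp add: complex_eq_iff)
  qed
  have CZ: "?Z \<in> carrier_mat n n" using Zc by simp
  have "spectral_radius ?Z \<in> norm ` spectrum ?Z"
    by (rule spectral_radius_mem_max(1)[OF CZ n])
  then have "spectral_radius ?Z = 0" using ev0 by (auto simp: spectrum_def)
  then obtain c where c: "norm_bound (?Z ^\<^sub>m k) c" for k
    using spectral_radius_jnf_norm_bound_less_1_upper_triangular[OF CZ] by auto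
  have "\<bar>(Z ^\<^sub>m k) $$ (i, j)\<bar> \<le> c" if "i < n" "j < n" for k i j
    using c[of k] that Zc unfolding of_real_hom.mat_hom_pow[OF Zc, symmetric] norm_bound_def
    by (auto simp del: pow_mat_dim)
  from power_bounded_imp_energy_less_double[OF S Z v this] v0
  have "form S (Z *\<^sub>v v) (Z *\<^sub>v v) < 2 * form S v v" by blast
  also have "form S (Z *\<^sub>v v) (Z *\<^sub>v v) = q * form S (X *\<^sub>v v) (X *\<^sub>v v)"
    unfolding Z_def smult_mat_mult_vec[OF Xc v] using Sc Xvc q
    by (simp add: form_linear[of S n] mult.assoc[symmetric])
  also have "\<dots> = 2 * form S v v"
    using form_pos[OF S Xvc Xv] by (simp add: q_def)
  finally show False by simp
qed

section \<open>The spectral theorem for self-adjoint matrices\<close>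

lemma spd_mat_inverse:
  assumes "spd_mat n S"
  shows "inv_mat S \<in> carrier_mat n n" "S * inv_mat S = 1\<^sub>m n" "inv_mat S * S = 1\<^sub>m n"
proof -
  note S = spd_carrier[OF assms]
  have "det S \<noteq> 0"
  proof
    assume "det S = 0"
    then obtain v where v: "v \<in> carrier_vec n" "v \<noteq> 0\<^sub>v n" "S *\<^sub>v v = 0\<^sub>v n"
      using det_0_iff_vec_prod_zero[OF S] by blast
    then have "form S v v = 0" by (simp add: form_def)
    with form_pos[OF assms v(1,2)] show False by simp
  qed
  then have "mat_inverse S \<noteq> None"
    using det_non_zero_imp_unit[OF S, of "()"] mat_inverse(1)[OF S, of "()"] by blast
  then obtain T where "mat_inverse S = Some T" by blast
  with mat_inverse(2)[OF S this]
  show "inv_mat S \<in> carrier_mat n n" "S * inv_mat S = 1\<^sub>m n" "inv_mat S * S = 1\<^sub>m n"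
    by (auto simp: inv_mat_def)
qed

lemma spd_mat_inverse_vec:
  assumes "spd_mat n S" "v \<in> carrier_vec n"
  shows "inv_mat S *\<^sub>v v \<in> carrier_vec n"
    "S *\<^sub>v (inv_mat S *\<^sub>v v) = v" "inv_mat S *\<^sub>v (S *\<^sub>v v) = v"
  using spd_mat_inverse[OF assms(1)] spd_carrier[OF assms(1)] assms(2)
  by (auto simp: assoc_mult_mat_vec[of _ n n _ n, symmetric])

lemma index_mult_mat_col:
  assumes "X \<in> carrier_mat n n" "Y \<in> carrier_mat n n" "i < n" "j < n"
  shows "(X * Y) $$ (i, j) = (X *\<^sub>v col Y j) $ i"
  using assms by simp

definition orthonormal :: "nat \<Rightarrow> real mat \<Rightarrow> nat \<Rightarrow> (nat \<Rightarrow> real vec) \<Rightarrow> bool" where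
  "orthonormal n S r e \<longleftrightarrow> (\<forall>i<r. e i \<in> carrier_vec n) \<and>
     (\<forall>i<r. \<forall>j<r. form S (e i) (e j) = (if i = j then 1 else 0))"

text \<open>The matrix with columns \<open>e 0, \<dots>, e (r - 1)\<close>, padded with zero columns to a square one, so that all matrices below
  have the same shape.\<close>

definition frame_mat :: "nat \<Rightarrow> nat \<Rightarrow> (nat \<Rightarrow> real vec) \<Rightarrow> real mat" where
  "frame_mat n r e = mat n n (\<lambda>(i, j). if j < r then e j $ i else 0)"

lemma frame_mat_carrier [simp]:
  "frame_mat n r e \<in> carrier_mat n n" "(frame_mat n r e)\<^sup>T \<in> carrier_mat n n"
  by (auto simp: frame_mat_def)

definition frame_coeffs :: "nat \<Rightarrow> real mat \<Rightarrow> nat \<Rightarrow> (nat \<Rightarrow> real vec) \<Rightarrow> real vec \<Rightarrow> real vec" where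
  "frame_coeffs n S r e u = vec n (\<lambda>j. if j < r then form S (e j) u else 0)"

lemma frame_coeffs_carrier [simp]: "frame_coeffs n S r e u \<in> carrier_vec n"
  by (simp add: frame_coeffs_def)

lemma frame_mat_transpose_mult:
  assumes "S \<in> carrier_mat n n" "orthonormal n S r e" "u \<in> carrier_vec n"
  shows "(frame_mat n r e)\<^sup>T *\<^sub>v (S *\<^sub>v u) = frame_coeffs n S r e u"
proof (rule eq_vecI)
  fix j assume "j < dim_vec (frame_coeffs n S r e u)"
  then have j: "j < n" by (simp add: frame_coeffs_def)
  show "((frame_mat n r e)\<^sup>T *\<^sub>v (S *\<^sub>v u)) $ j = frame_coeffs n S r e u $ j"
  proof (cases "j < r")
    case True
    then have "col (frame_mat n r e) j = e j"
      using j assms(2) by (intro eq_vecI) (auto simp: frame_mat_def orthonormal_def)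
    then show ?thesis using j True by (simp add: frame_mat_def frame_coeffs_def form_def)
  next
    case False
    then have "col (frame_mat n r e) j = 0\<^sub>v n"
      using j by (intro eq_vecI) (auto simp: frame_mat_def)
    then show ?thesis using j False assms by (simp add: frame_mat_def frame_coeffs_def)
  qed
qed (simp add: frame_mat_def frame_coeffs_def)

lemma form_frame_mat:
  assumes S: "spd_mat n S" and e: "orthonormal n S r e"
    and u: "u \<in> carrier_vec n" and x: "x \<in> carrier_vec n"
  shows "form S u (frame_mat n r e *\<^sub>v x) = frame_coeffs n S r e u \<bullet> x"
proof -
  note Sc = spd_carrier[OF S]
  have Vx: "frame_mat n r e *\<^sub>v x \<in> carrier_vec n"
    by (rule mult_mat_vec_carrier[OF frame_mat_carrier(1) x])
  have "form S u (frame_mat n r e *\<^sub>v x) = form S (frame_mat n r e *\<^sub>v x) u"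
    using form_commute[OF S u Vx] .
  also have "\<dots> = (S *\<^sub>v u) \<bullet> (frame_mat n r e *\<^sub>v x)"
    unfolding form_def using Vx Sc u by (auto intro: comm_scalar_prod[of _ n])
  also have "\<dots> = frame_coeffs n S r e u \<bullet> x"
    using transpose_vec_mult_scalar[OF frame_mat_carrier(1) x, of "S *\<^sub>v u" r e]
      frame_mat_transpose_mult[OF Sc e u] Sc u by simp
  finally show ?thesis .
qed

lemma frame_coeffs_basis:
  assumes "orthonormal n S r e" "i < r" "r \<le> n"
  shows "frame_coeffs n S r e (e i) = unit_vec n i"
  using assms by (intro eq_vecI) (auto simp: frame_coeffs_def orthonormal_def)

text \<open>The square matrix whose rows are \<open>S e\<^sub>i\<close>, padded with zero rows, is singular as \<open>r < n\<close>.\<close>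

lemma ex_orthogonal_to_frame:
  assumes S: "spd_mat n S" and e: "orthonormal n S r e" and r: "r < n"
  shows "\<exists>w \<in> carrier_vec n. w \<noteq> 0\<^sub>v n \<and> (\<forall>i<r. form S (e i) w = 0)"
proof -
  note Sc = spd_carrier[OF S]
  have ec: "i < r \<Longrightarrow> e i \<in> carrier_vec n" for i using e by (simp add: orthonormal_def)
  define row' where "row' i = (if i < r then S *\<^sub>v e i else 0\<^sub>v n)" for i
  define N where "N = mat\<^sub>r n n (\<lambda>i. if i = n - 1 then 0\<^sub>v n else row' i)"
  have rc: "row' i \<in> carrier_vec n" for i using ec Sc by (simp add: row'_def)
  have "det N = 0" unfolding N_def using r rc by (intro det_row_0) auto
  moreover have N: "N \<in> carrier_mat n n" by (simp add: N_def)
  ultimately obtain w where w: "w \<in> carrier_vec n" "w \<noteq> 0\<^sub>v n" "N *\<^sub>v w = 0\<^sub>v n"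
    using det_0_iff_vec_prod_zero by blast
  have "form S (e i) w = 0" if i: "i < r" for i
  proof (cases "i = n - 1")
    case True
    then show ?thesis using i r by simp
  next
    case False
    have "row N i = S *\<^sub>v e i"
      unfolding N_def using i r False rc Sc by (subst row_mat_of_row_fun) (auto simp: row'_def)
    then have "(S *\<^sub>v e i) \<bullet> w = 0"
      using arg_cong[OF w(3), of "\<lambda>v. v $ i"] i r N by simp
    then show ?thesis
      using form_commute[OF S ec[OF i] w(1)] comm_scalar_prod[of w n "S *\<^sub>v e i"] w ec[OF i] Sc
      by (simp add: form_def)
  qed
  with w show ?thesis by blast
qed

text \<open>Deflation: let \<open>R\<close> be the orthogonal projection onto the complement of the eigenvectors found so far. The matrix
  \<open>R X R\<close> is again self-adjoint. If it is nonzero, it has an eigenvector for a nonzero eigenvalue, which lies in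
  the range of \<open>R\<close>; if it is zero, any vector in that range is an eigenvector. On the range of \<open>R\<close>, which \<open>X\<close> leaves
  invariant, \<open>R X R\<close> agrees with \<open>X\<close>, so in both cases an eigenvector of \<open>X\<close> is found.\<close>

lemma orthonormal_eigenvectors_extend:
  assumes S: "spd_mat n S" and X: "self_adjoint n S X"
    and e: "orthonormal n S r e" and r: "r < n"
    and ev: "\<And>i. i < r \<Longrightarrow> X *\<^sub>v e i = d i \<cdot>\<^sub>v e i"
  shows "\<exists>w \<in> carrier_vec n. \<exists>\<mu>. X *\<^sub>v w = \<mu> \<cdot>\<^sub>v w \<and> form S w w = 1 \<and> (\<forall>i<r. form S (e i) w = 0)"
proof -
  note Sc = spd_carrier[OF S] and Xc = self_adjointD(1)[OF X]
  have ec: "i < r \<Longrightarrow> e i \<in> carrier_vec n" for i using e by (simp add: orthonormal_def)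
  define V where "V = frame_mat n r e"
  have V: "V \<in> carrier_mat n n" "V\<^sup>T \<in> carrier_mat n n" by (simp_all add: V_def)
  \<comment> \<open>As the columns are \<open>S\<close>-orthonormal, \<open>V V\<^sup>T S\<close> is the \<open>S\<close>-orthogonal projection onto their span.\<close>
  define R where "R = 1\<^sub>m n - V * (V\<^sup>T * S)"
  have R: "R \<in> carrier_mat n n" using V Sc by (auto simp: R_def)
  have R_vec: "R *\<^sub>v u = u - V *\<^sub>v frame_coeffs n S r e u" if u: "u \<in> carrier_vec n" for u
  proof -
    have "R *\<^sub>v u = u - V *\<^sub>v (V\<^sup>T *\<^sub>v (S *\<^sub>v u))"
      unfolding R_def using V Sc u
      by (simp add: minus_mult_distrib_mat_vec[of _ n n] assoc_mult_mat_vec[of _ n n _ n])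
    then show ?thesis using frame_mat_transpose_mult[OF Sc e u] by (simp add: V_def)
  qed
  have Rc: "R *\<^sub>v u \<in> carrier_vec n" if "u \<in> carrier_vec n" for u using R that by simp
  have form_R: "form S u (R *\<^sub>v v) = form S u v - frame_coeffs n S r e u \<bullet> frame_coeffs n S r e v"
    if "u \<in> carrier_vec n" "v \<in> carrier_vec n" for u v
  proof -
    have "V *\<^sub>v frame_coeffs n S r e v \<in> carrier_vec n"
      by (rule mult_mat_vec_carrier[OF V(1) frame_coeffs_carrier])
    then show ?thesis
      using form_frame_mat[OF S e that(1), of "frame_coeffs n S r e v"] that Sc
      by (simp add: R_vec form_minus_right[of S n] V_def)
  qed
  have R_self: "form S (R *\<^sub>v u) v = form S u (R *\<^sub>v v)"
    if "u \<in> carrier_vec n" "v \<in> carrier_vec n" for u v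
  proof -
    have "form S (R *\<^sub>v u) v = form S v (R *\<^sub>v u)" using form_commute[OF S] that Rc by blast
    then show ?thesis
      using form_R that form_commute[OF S that] comm_scalar_prod[of "frame_coeffs n S r e u" n]
      by simp
  qed
  have R_orth: "form S (e i) (R *\<^sub>v u) = 0" if "u \<in> carrier_vec n" "i < r" for u i
    using form_R[OF ec[OF that(2)] that(1)] frame_coeffs_basis[OF e that(2)] r that
    by (simp add: frame_coeffs_def)
  have R_id: "R *\<^sub>v u = u" if "u \<in> carrier_vec n" "\<And>i. i < r \<Longrightarrow> form S (e i) u = 0" for u
  proof -
    have "frame_coeffs n S r e u = 0\<^sub>v n" using that by (intro eq_vecI) (auto simp: frame_coeffs_def)
    moreover have "V *\<^sub>v 0\<^sub>v n = 0\<^sub>v n" using V by (intro eq_vecI) auto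
    ultimately show ?thesis using R_vec that by simp
  qed
  define Y where "Y = R * (X * R)"
  have Y_vec: "Y *\<^sub>v u = R *\<^sub>v (X *\<^sub>v (R *\<^sub>v u))" if "u \<in> carrier_vec n" for u
    unfolding Y_def using R Xc that by (simp add: assoc_mult_mat_vec[of _ n n _ n])
  have Y: "self_adjoint n S Y"
    unfolding self_adjoint_def
  proof (intro conjI ballI)
    show "Y \<in> carrier_mat n n" using R Xc by (auto simp: Y_def)
    fix u v :: "real vec" assume uv: "u \<in> carrier_vec n" "v \<in> carrier_vec n"
    have XR: "X *\<^sub>v (R *\<^sub>v u) \<in> carrier_vec n" for u
      using Xc R by (metis carrier_matD(1) carrier_vecI dim_mult_mat_vec)
    show "form S (Y *\<^sub>v u) v = form S u (Y *\<^sub>v v)"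
      using R_self[OF XR uv(2)] self_adjointD(2)[OF X Rc[OF uv(1)] Rc[OF uv(2)]]
        R_self[OF uv(1) XR] uv by (simp add: Y_vec)
  qed
  obtain w \<mu> where w: "w \<in> carrier_vec n" "w \<noteq> 0\<^sub>v n" and Yw: "Y *\<^sub>v w = \<mu> \<cdot>\<^sub>v w"
    and orth: "\<And>i. i < r \<Longrightarrow> form S (e i) w = 0"
  proof (cases "\<exists>v \<in> carrier_vec n. Y *\<^sub>v v \<noteq> 0\<^sub>v n")
    case True
    then obtain \<mu> w where \<mu>: "\<mu> \<noteq> 0" and w: "w \<in> carrier_vec n" "w \<noteq> 0\<^sub>v n" "Y *\<^sub>v w = \<mu> \<cdot>\<^sub>v w"
      using self_adjoint_nonzero_eigenvalue[OF S Y] by blast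
    have "form S (e i) w = 0" if i: "i < r" for i
    proof -
      have "X *\<^sub>v (R *\<^sub>v w) \<in> carrier_vec n" using Xc Rc w by simp
      then have "form S (e i) (\<mu> \<cdot>\<^sub>v w) = 0"
        using R_orth[OF _ i] w Y_vec by metis
      then show ?thesis using \<mu> w ec[OF i] Sc by (simp add: form_linear[of S n])
    qed
    with w show ?thesis by (rule that[of w \<mu>])
  next
    case False
    obtain w where w: "w \<in> carrier_vec n" "w \<noteq> 0\<^sub>v n" "\<And>i. i < r \<Longrightarrow> form S (e i) w = 0"
      using ex_orthogonal_to_frame[OF S e r] by blast
    have "Y *\<^sub>v w = 0 \<cdot>\<^sub>v w" using False w by auto
    with w show ?thesis by (intro that[of w 0]) auto
  qed
  have Xw: "X *\<^sub>v w \<in> carrier_vec n" using Xc w by simp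
  have "form S (e i) (X *\<^sub>v w) = 0" if "i < r" for i
    using self_adjointD(2)[OF X ec[OF that] w(1)] ev[OF that] ec[OF that] w Sc orth[OF that]
    by (simp add: form_linear[of S n])
  then have "R *\<^sub>v (X *\<^sub>v w) = X *\<^sub>v w" by (rule R_id[OF Xw])
  then have Xw_eq: "X *\<^sub>v w = \<mu> \<cdot>\<^sub>v w"
    using Yw Y_vec[OF w(1)] R_id[OF w(1) orth] by simp
  define c where "c = 1 / sqrt (form S w w)"
  have c: "c * (c * form S w w) = 1"
    using form_pos[OF S w] by (simp add: c_def field_simps)
  show ?thesis
  proof (intro bexI exI conjI allI impI)
    show "X *\<^sub>v (c \<cdot>\<^sub>v w) = \<mu> \<cdot>\<^sub>v (c \<cdot>\<^sub>v w)"
      using Xw_eq w by (simp add: mult_mat_vec[OF Xc] smult_smult_assoc mult.commute)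
    show "form S (c \<cdot>\<^sub>v w) (c \<cdot>\<^sub>v w) = 1"
      using c w Sc by (simp add: form_linear[of S n])
    show "form S (e i) (c \<cdot>\<^sub>v w) = 0" if "i < r" for i
      using orth[OF that] ec[OF that] w Sc by (simp add: form_linear[of S n])
  qed (use w in simp)
qed

theorem self_adjoint_spectral:
  assumes S: "spd_mat n S" and X: "self_adjoint n S X"
  shows "\<exists>e d. orthonormal n S n e \<and> (\<forall>i<n. X *\<^sub>v e i = d i \<cdot>\<^sub>v e i)"
proof -
  have "r \<le> n \<Longrightarrow> \<exists>e d. orthonormal n S r e \<and> (\<forall>i<r. X *\<^sub>v e i = d i \<cdot>\<^sub>v e i)" for r
  proof (induction r)
    case 0
    then show ?case by (simp add: orthonormal_def)
  next
    case (Suc r)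
    then obtain e d where e: "orthonormal n S r e" and ev: "\<And>i. i < r \<Longrightarrow> X *\<^sub>v e i = d i \<cdot>\<^sub>v e i"
      by auto
    obtain w \<mu> where w: "w \<in> carrier_vec n" "X *\<^sub>v w = \<mu> \<cdot>\<^sub>v w" "form S w w = 1"
      "\<And>i. i < r \<Longrightarrow> form S (e i) w = 0"
      using orthonormal_eigenvectors_extend[OF S X e _ ev] Suc.prems by auto
    have ec: "i < r \<Longrightarrow> e i \<in> carrier_vec n" for i using e by (simp add: orthonormal_def)
    have "form S w (e i) = 0" if "i < r" for i
      using form_commute[OF S w(1) ec[OF that]] w(4)[OF that] by simp
    then have "orthonormal n S (Suc r) (e(r := w))"
      using e w by (auto simp: orthonormal_def less_Suc_eq)
    moreover have "\<forall>i<Suc r. X *\<^sub>v (e(r := w)) i = (d(r := \<mu>)) i \<cdot>\<^sub>v (e(r := w)) i"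
      using ev w by (auto simp: less_Suc_eq)
    ultimately show ?case by blast
  qed
  then show ?thesis by blast
qed

text \<open>For a full orthonormal system \<open>V\<^sup>T S\<close> is a left inverse of \<open>V\<close>, hence also a right inverse, which is
  completeness.\<close>

lemma orthonormal_Parseval:
  assumes S: "spd_mat n S" and e: "orthonormal n S n e"
    and u: "u \<in> carrier_vec n" and v: "v \<in> carrier_vec n"
  shows "form S u v = (\<Sum>i<n. form S (e i) u * form S (e i) v)"
proof -
  note Sc = spd_carrier[OF S]
  have ec: "i < n \<Longrightarrow> e i \<in> carrier_vec n" for i using e by (simp add: orthonormal_def)
  define V where "V = frame_mat n n e"
  have V: "V \<in> carrier_mat n n" "V\<^sup>T \<in> carrier_mat n n" by (simp_all add: V_def)
  have "(V\<^sup>T * S) * V = 1\<^sub>m n"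
  proof (rule eq_matI)
    fix i j assume "i < dim_row (1\<^sub>m n :: real mat)" "j < dim_col (1\<^sub>m n :: real mat)"
    then have ij: "i < n" "j < n" by auto
    have colV: "col V j = e j"
      using ij ec[OF ij(2)] by (intro eq_vecI) (auto simp: V_def frame_mat_def)
    have "V\<^sup>T * S \<in> carrier_mat n n" using V Sc by simp
    then have "((V\<^sup>T * S) * V) $$ (i, j) = ((V\<^sup>T * S) *\<^sub>v e j) $ i"
      unfolding colV[symmetric] by (rule index_mult_mat_col[OF _ V(1) ij])
    also have "(V\<^sup>T * S) *\<^sub>v e j = frame_coeffs n S n e (e j)"
      by (rule trans[OF assoc_mult_mat_vec[OF V(2) Sc ec[OF ij(2)]]
            frame_mat_transpose_mult[OF Sc e ec[OF ij(2)], folded V_def]])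
    finally show "((V\<^sup>T * S) * V) $$ (i, j) = (1\<^sub>m n) $$ (i, j)"
      using ij by (simp add: frame_coeffs_basis[OF e])
  qed (use V Sc in auto)
  then have id: "V * (V\<^sup>T * S) = 1\<^sub>m n"
    using mat_mult_left_right_inverse[of "V\<^sup>T * S" n V] V Sc by simp
  have VTS: "V\<^sup>T * S \<in> carrier_mat n n" using V Sc by simp
  have "V *\<^sub>v frame_coeffs n S n e v = (V * (V\<^sup>T * S)) *\<^sub>v v"
    unfolding assoc_mult_mat_vec[OF V(1) VTS v] assoc_mult_mat_vec[OF V(2) Sc v]
      frame_mat_transpose_mult[OF Sc e v, folded V_def] ..
  then have "v = V *\<^sub>v frame_coeffs n S n e v" using id v by simp
  then have "form S u v = frame_coeffs n S n e u \<bullet> frame_coeffs n S n e v"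
    using form_frame_mat[OF S e u, of "frame_coeffs n S n e v"] by (simp add: V_def)
  also have "\<dots> = (\<Sum>i<n. form S (e i) u * form S (e i) v)"
    by (simp add: scalar_prod_def frame_coeffs_def atLeast0LessThan)
  finally show ?thesis .
qed

section \<open>Polynomials in a matrix and the Chebyshev iteration\<close>

lemma poly_mat_carrier [simp]: "X \<in> carrier_mat n n \<Longrightarrow> poly_mat p X \<in> carrier_mat n n"
  by (simp add: poly_mat_def)

lemma dim_row_poly_mat [simp]: "dim_row (poly_mat p X) = dim_row X"
  by (simp add: poly_mat_def)

lemma zero_smult_real_vec: "v \<in> carrier_vec n \<Longrightarrow> 0 \<cdot>\<^sub>v v = (0\<^sub>v n :: real vec)"
  by (intro eq_vecI) auto

lemma mat_eqI_mult_vec: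
  fixes X Y :: "real mat"
  assumes X: "X \<in> carrier_mat n n" and Y: "Y \<in> carrier_mat n n"
    and eq: "\<And>v. v \<in> carrier_vec n \<Longrightarrow> X *\<^sub>v v = Y *\<^sub>v v"
  shows "X = Y"
proof (rule eq_matI)
  fix i j assume "i < dim_row Y" "j < dim_col Y"
  then have ij: "i < n" "j < n" using Y by auto
  have "(X * 1\<^sub>m n) $$ (i, j) = (Y * 1\<^sub>m n) $$ (i, j)"
    unfolding index_mult_mat_col[OF X one_carrier_mat ij] index_mult_mat_col[OF Y one_carrier_mat ij]
    by (simp only: eq[OF col_carrier_vec[OF ij(2) one_carrier_mat]])
  then show "X $$ (i, j) = Y $$ (i, j)" using X Y by simp
qed (use X Y in auto)

lemma poly_mat_vec_index:
  assumes X: "X \<in> carrier_mat n n" and v: "v \<in> carrier_vec n" and i: "i < n" and N: "degree p \<le> N"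
  shows "(poly_mat p X *\<^sub>v v) $ i = (\<Sum>k\<le>N. poly.coeff p k * ((X ^\<^sub>m k) *\<^sub>v v) $ i)"
proof -
  have "(poly_mat p X *\<^sub>v v) $ i
      = (\<Sum>j = 0..<n. (\<Sum>k\<le>degree p. poly.coeff p k * (X ^\<^sub>m k) $$ (i, j)) * v $ j)"
    using X v i by (simp add: poly_mat_def scalar_prod_def)
  also have "\<dots> = (\<Sum>k\<le>degree p. \<Sum>j = 0..<n. poly.coeff p k * (X ^\<^sub>m k) $$ (i, j) * v $ j)"
    by (simp add: sum_distrib_right) (rule sum.swap)
  also have "\<dots> = (\<Sum>k\<le>degree p. poly.coeff p k * ((X ^\<^sub>m k) *\<^sub>v v) $ i)"
    using X v i by (intro sum.cong refl) (simp add: scalar_prod_def sum_distrib_left mult.assoc)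
  also have "\<dots> = (\<Sum>k\<le>N. poly.coeff p k * ((X ^\<^sub>m k) *\<^sub>v v) $ i)"
    using N by (intro sum.mono_neutral_left) (auto simp: coeff_eq_0)
  finally show ?thesis .
qed

lemma poly_mat_add_vec:
  assumes "X \<in> carrier_mat n n" "v \<in> carrier_vec n"
  shows "poly_mat (p + q) X *\<^sub>v v = poly_mat p X *\<^sub>v v + poly_mat q X *\<^sub>v v"
proof (rule eq_vecI)
  fix i assume "i < dim_vec (poly_mat p X *\<^sub>v v + poly_mat q X *\<^sub>v v)"
  then have i: "i < n" using assms by (simp add: poly_mat_def)
  let ?N = "max (degree p) (degree q)"
  show "(poly_mat (p + q) X *\<^sub>v v) $ i = (poly_mat p X *\<^sub>v v + poly_mat q X *\<^sub>v v) $ i"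
    using poly_mat_vec_index[OF assms i, of _ ?N] degree_add_le[of p ?N q] i assms
    by (simp add: algebra_simps sum.distrib del: index_mult_mat_vec)
qed (use assms in \<open>simp add: poly_mat_def\<close>)

lemma poly_mat_smult_vec:
  assumes "X \<in> carrier_mat n n" "v \<in> carrier_vec n"
  shows "poly_mat (Polynomial.smult c p) X *\<^sub>v v = c \<cdot>\<^sub>v (poly_mat p X *\<^sub>v v)"
proof (rule eq_vecI)
  fix i assume "i < dim_vec (c \<cdot>\<^sub>v (poly_mat p X *\<^sub>v v))"
  then have i: "i < n" using assms by (simp add: poly_mat_def)
  show "(poly_mat (Polynomial.smult c p) X *\<^sub>v v) $ i = (c \<cdot>\<^sub>v (poly_mat p X *\<^sub>v v)) $ i"
    using poly_mat_vec_index[OF assms i, of _ "degree p"] i assms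
    by (simp add: sum_distrib_left mult.assoc del: index_mult_mat_vec)
qed (use assms in \<open>simp add: poly_mat_def\<close>)

lemma poly_mat_diff_vec:
  assumes "X \<in> carrier_mat n n" "v \<in> carrier_vec n"
  shows "poly_mat (p - q) X *\<^sub>v v = poly_mat p X *\<^sub>v v - poly_mat q X *\<^sub>v v"
  using poly_mat_add_vec[OF assms, of p "Polynomial.smult (- 1) q"]
    poly_mat_smult_vec[OF assms, of "- 1" q] assms
  by (auto intro!: eq_vecI simp: poly_mat_def)

lemma poly_mat_pCons_vec:
  assumes "X \<in> carrier_mat n n" "v \<in> carrier_vec n"
  shows "poly_mat (pCons a p) X *\<^sub>v v = a \<cdot>\<^sub>v v + X *\<^sub>v (poly_mat p X *\<^sub>v v)"
proof (rule eq_vecI)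
  fix i assume "i < dim_vec (a \<cdot>\<^sub>v v + X *\<^sub>v (poly_mat p X *\<^sub>v v))"
  then have i: "i < n" using assms by simp
  let ?x = "\<lambda>k. (X ^\<^sub>m k) *\<^sub>v v"
  have x_Suc: "?x (Suc k) = X *\<^sub>v ?x k" for k
    unfolding pow_mat_funpow[OF assms] by simp
  have "(poly_mat (pCons a p) X *\<^sub>v v) $ i = a * v $ i + (\<Sum>k\<le>degree p. poly.coeff p k * ?x (Suc k) $ i)"
    unfolding poly_mat_vec_index[OF assms i degree_pCons_le[of a p]] sum.atMost_Suc_shift
    using assms i by (simp del: pow_mat.simps(2) index_mult_mat_vec)
  also have "(\<Sum>k\<le>degree p. poly.coeff p k * ?x (Suc k) $ i)
      = (\<Sum>k\<le>degree p. \<Sum>j = 0..<n. X $$ (i, j) * (poly.coeff p k * ?x k $ j))"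
    unfolding x_Suc using assms i
    by (intro sum.cong refl) (simp add: scalar_prod_def sum_distrib_left mult_ac)
  also have "\<dots> = (\<Sum>j = 0..<n. X $$ (i, j) * (\<Sum>k\<le>degree p. poly.coeff p k * ?x k $ j))"
    by (subst sum.swap) (simp add: sum_distrib_left)
  also have "\<dots> = (\<Sum>j = 0..<n. X $$ (i, j) * (poly_mat p X *\<^sub>v v) $ j)"
    using poly_mat_vec_index[OF assms, of _ p "degree p"] by (intro sum.cong refl) auto
  also have "\<dots> = (X *\<^sub>v (poly_mat p X *\<^sub>v v)) $ i"
    using assms i by (simp add: scalar_prod_def poly_mat_def)
  finally show "(poly_mat (pCons a p) X *\<^sub>v v) $ i = (a \<cdot>\<^sub>v v + X *\<^sub>v (poly_mat p X *\<^sub>v v)) $ i"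
    using assms i by simp
qed (use assms in \<open>simp add: poly_mat_def\<close>)

lemma poly_mat_0_vec:
  assumes "X \<in> carrier_mat n n" "v \<in> carrier_vec n"
  shows "poly_mat 0 X *\<^sub>v v = 0\<^sub>v n"
  using assms by (intro eq_vecI) (auto simp: poly_mat_def scalar_prod_def)

lemma poly_mat_1_vec:
  assumes "X \<in> carrier_mat n n" "v \<in> carrier_vec n"
  shows "poly_mat 1 X *\<^sub>v v = v"
proof -
  have "X *\<^sub>v 0\<^sub>v n = 0\<^sub>v n" using assms by (intro eq_vecI) auto
  then show ?thesis
    using poly_mat_pCons_vec[OF assms, of 1 0] poly_mat_0_vec[OF assms] assms
    by (simp add: one_pCons)
qed

lemma poly_mat_eigenvector:
  assumes X: "X \<in> carrier_mat n n" and v: "v \<in> carrier_vec n" and ev: "X *\<^sub>v v = \<mu> \<cdot>\<^sub>v v"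
  shows "poly_mat p X *\<^sub>v v = poly p \<mu> \<cdot>\<^sub>v v"
proof (induction p)
  case 0
  show ?case using v by (simp add: poly_mat_0_vec[OF X v] zero_smult_real_vec)
next
  case (pCons a p)
  show ?case
    using v by (simp add: poly_mat_pCons_vec[OF X v] pCons.IH mult_mat_vec[OF X] ev
        smult_smult_assoc add_smult_distrib_vec[symmetric] mult.commute)
qed

lemma self_adjoint_poly_mat:
  assumes X: "self_adjoint n S X" and S: "S \<in> carrier_mat n n"
  shows "self_adjoint n S (poly_mat p X)"
proof (induction p)
  case 0
  show ?case
    using self_adjointD(1)[OF X] S unfolding self_adjoint_def
    by (auto simp: poly_mat_0_vec form_zero[of S n])
next
  case (pCons a p)
  note Xc = self_adjointD(1)[OF X] and pX = pCons.IH
  have pc: "poly_mat p X *\<^sub>v v \<in> carrier_vec n" if "v \<in> carrier_vec n" for v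
    using poly_mat_carrier[OF Xc] that by (rule mult_mat_vec_carrier)
  have comm: "poly_mat p X *\<^sub>v (X *\<^sub>v v) = X *\<^sub>v (poly_mat p X *\<^sub>v v)" if v: "v \<in> carrier_vec n" for v
  proof (induction p)
    case 0
    have "X *\<^sub>v 0\<^sub>v n = 0\<^sub>v n" using Xc by (intro eq_vecI) auto
    then show ?case using v Xc by (simp add: poly_mat_0_vec[of X n])
  next
    case (pCons a p)
    have "poly_mat p X *\<^sub>v v \<in> carrier_vec n"
      using poly_mat_carrier[OF Xc] v by (rule mult_mat_vec_carrier)
    then show ?case
      using v Xc by (simp add: poly_mat_pCons_vec[of X n] pCons.IH mult_add_distrib_mat_vec[of X n n]
          mult_mat_vec[OF Xc])
  qed
  show ?case
    unfolding self_adjoint_def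
  proof (intro conjI ballI)
    fix u v :: "real vec" assume uv: "u \<in> carrier_vec n" "v \<in> carrier_vec n"
    have "form S (X *\<^sub>v (poly_mat p X *\<^sub>v u)) v = form S (poly_mat p X *\<^sub>v u) (X *\<^sub>v v)"
      using self_adjointD(2)[OF X pc[OF uv(1)] uv(2)] .
    also have "\<dots> = form S u (poly_mat p X *\<^sub>v (X *\<^sub>v v))"
      using self_adjointD(2)[OF pX uv(1)] uv Xc by simp
    finally have "form S (X *\<^sub>v (poly_mat p X *\<^sub>v u)) v = form S u (X *\<^sub>v (poly_mat p X *\<^sub>v v))"
      using comm[OF uv(2)] by simp
    moreover have "X *\<^sub>v (poly_mat p X *\<^sub>v w) \<in> carrier_vec n" if "w \<in> carrier_vec n" for w
      using Xc pc[OF that] by simp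
    ultimately show "form S (poly_mat (pCons a p) X *\<^sub>v u) v = form S u (poly_mat (pCons a p) X *\<^sub>v v)"
      using uv S by (simp add: poly_mat_pCons_vec[OF Xc] form_linear[of S n])
  qed (use Xc in simp)
qed

lemma cheb4_p_0: "cheb4_p 0 = 1"
  by (simp add: cheb4_p_def)

text \<open>The polynomial that yields the increment \<open>z\<^sub>j\<close> of the iteration from the initial error: the \<open>j\<close>-th error is
  \<open>p\<^sub>j(BA) e\<^sub>0\<close>, so \<open>z\<^sub>j\<close> is the difference of two consecutive errors, and \<open>z\<^sub>0 = 0\<close>.\<close>

definition cheb4_increment :: "nat \<Rightarrow> real poly" where
  "cheb4_increment j = (case j of 0 \<Rightarrow> 0 | Suc i \<Rightarrow> cheb4_p i - cheb4_p (Suc i))"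

text \<open>The three-term recurrence of the \<open>W\<^sub>j\<close>, divided by \<open>2 j + 3\<close> and rewritten for differences, has exactly the
  coefficients of the iteration. For \<open>j = 0\<close> the coefficient of the previous increment is negative but meets a zero
  increment.\<close>

lemma cheb4_increment_Suc:
  "cheb4_increment (Suc j) =
     Polynomial.smult ((2 * real (Suc j) - 3) / (2 * real (Suc j) + 1)) (cheb4_increment j)
     + Polynomial.smult ((8 * real (Suc j) - 4) / (2 * real (Suc j) + 1)) (pCons 0 (cheb4_p j))"
proof -
  have "poly (cheb4_increment (Suc j)) x = (2 * real (Suc j) - 3) / (2 * real (Suc j) + 1) * poly (cheb4_increment j) x
     + (8 * real (Suc j) - 4) / (2 * real (Suc j) + 1) * (x * poly (cheb4_p j) x)" for x
  proof (cases j)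
    case 0
    then show ?thesis by (simp add: cheb4_increment_def poly_cheb4_p field_simps)
  next
    case (Suc m)
    define a b where "a = poly (cheb4_W m) (1 - 2 * x)" and "b = poly (cheb4_W (Suc m)) (1 - 2 * x)"
    define t where "t = real m"
    have t: "0 \<le> t" by (simp add: t_def)
    have p: "poly (cheb4_p m) x = a / (2 * t + 1)" "poly (cheb4_p (Suc m)) x = b / (2 * t + 3)"
      "poly (cheb4_p (Suc (Suc m))) x = (2 * (1 - 2 * x) * b - a) / (2 * t + 5)"
      by (simp_all add: poly_cheb4_p a_def b_def t_def algebra_simps)
    have "b / (2 * t + 3) - (2 * (1 - 2 * x) * b - a) / (2 * t + 5)
       = (2 * t + 1) / (2 * t + 5) * (a / (2 * t + 1) - b / (2 * t + 3))
         + (8 * t + 12) / (2 * t + 5) * (x * (b / (2 * t + 3)))"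
      using t by (simp add: divide_simps) (simp add: algebra_simps)
    then show ?thesis
      unfolding Suc by (simp add: cheb4_increment_def p del: of_nat_Suc)
        (simp add: t_def algebra_simps)
  qed
  then show ?thesis by (intro poly_eq_poly_eq_iff[THEN iffD1] ext) simp
qed

lemma cheb4_iter_error:
  assumes A: "spd_mat n A" and B: "B \<in> carrier_mat n n"
    and b: "b \<in> carrier_vec n" and x0: "x0 \<in> carrier_vec n"
  shows "inv_mat A *\<^sub>v b - fst (cheb4_iter A B b x0 j) = poly_mat (cheb4_p j) (B * A) *\<^sub>v (inv_mat A *\<^sub>v b - x0)
    \<and> snd (cheb4_iter A B b x0 j) = poly_mat (cheb4_increment j) (B * A) *\<^sub>v (inv_mat A *\<^sub>v b - x0)
    \<and> fst (cheb4_iter A B b x0 j) \<in> carrier_vec n"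
proof (induction j)
  case 0
  note Ac = spd_carrier[OF A]
  have "B * A \<in> carrier_mat n n" "inv_mat A *\<^sub>v b - x0 \<in> carrier_vec n"
    using Ac B spd_mat_inverse_vec(1)[OF A b] x0 by auto
  then show ?case
    using Ac x0 by (simp add: cheb4_p_0 cheb4_increment_def poly_mat_1_vec poly_mat_0_vec)
next
  case (Suc j)
  note Ac = spd_carrier[OF A]
  define X where "X = B * A"
  have X: "X \<in> carrier_mat n n" using Ac B by (simp add: X_def)
  define s where "s = inv_mat A *\<^sub>v b"
  have s: "s \<in> carrier_vec n" "A *\<^sub>v s = b" using spd_mat_inverse_vec[OF A b] by (auto simp: s_def)
  define e where "e = s - x0"
  have e: "e \<in> carrier_vec n" using s x0 by (simp add: e_def)
  obtain x z where xz: "cheb4_iter A B b x0 j = (x, z)" by fastforce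
  have x: "x \<in> carrier_vec n" and sx: "s - x = poly_mat (cheb4_p j) X *\<^sub>v e"
    and z: "z = poly_mat (cheb4_increment j) X *\<^sub>v e"
    using Suc.IH unfolding xz by (auto simp: s_def e_def X_def)
  let ?a = "(2 * real (Suc j) - 3) / (2 * real (Suc j) + 1)"
  let ?c = "(8 * real (Suc j) - 4) / (2 * real (Suc j) + 1)"
  define z' where "z' = ?a \<cdot>\<^sub>v z + ?c \<cdot>\<^sub>v (B *\<^sub>v (b - A *\<^sub>v x))"
  have step: "cheb4_iter A B b x0 (Suc j) = (x + z', z')"
    by (simp only: cheb4_iter.simps xz Let_def prod.case z'_def)
  have pc: "poly_mat p X *\<^sub>v e \<in> carrier_vec n" for p
    using poly_mat_carrier[OF X] e by (rule mult_mat_vec_carrier)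
  have "b - A *\<^sub>v x = A *\<^sub>v (s - x)"
    using mult_minus_distrib_mat_vec[OF Ac s(1) x] s by simp
  then have "B *\<^sub>v (b - A *\<^sub>v x) = X *\<^sub>v (s - x)"
    using assoc_mult_mat_vec[OF B Ac, of "s - x"] s x by (simp add: X_def)
  also have "\<dots> = poly_mat (pCons 0 (cheb4_p j)) X *\<^sub>v e"
  proof -
    have "X *\<^sub>v (poly_mat (cheb4_p j) X *\<^sub>v e) \<in> carrier_vec n" using X pc by simp
    then show ?thesis using sx e by (simp add: poly_mat_pCons_vec[OF X e] zero_smult_real_vec)
  qed
  finally have z': "z' = poly_mat (cheb4_increment (Suc j)) X *\<^sub>v e"
    unfolding z'_def z cheb4_increment_Suc
    by (simp only: poly_mat_add_vec[OF X e] poly_mat_smult_vec[OF X e])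
  have z'c: "z' \<in> carrier_vec n" unfolding z' by (rule pc)
  have "s - (x + z') = (s - x) - z'" using s x z'c by (intro eq_vecI) auto
  also have "\<dots> = poly_mat (cheb4_p j - cheb4_increment (Suc j)) X *\<^sub>v e"
    unfolding z' sx by (simp only: poly_mat_diff_vec[OF X e])
  also have "cheb4_p j - cheb4_increment (Suc j) = cheb4_p (Suc j)"
    by (simp add: cheb4_increment_def)
  finally have "s - (x + z') = poly_mat (cheb4_p (Suc j)) X *\<^sub>v e" .
  then show ?case
    unfolding step using z' x z'c by (simp add: s_def e_def X_def)
qed

text \<open>Every vector occurs as an initial error, for instance with \<open>b = 0\<close> and \<open>x\<^sub>0 = - v\<close>.\<close>

lemma cheb4_iteration_matrix_eq_poly_mat:
  assumes A: "spd_mat n A" and B: "B \<in> carrier_mat n n"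
    and G: "cheb4_iteration_matrix n k A B G"
  shows "G = poly_mat (cheb4_p k) (B * A)"
proof -
  note Ac = spd_carrier[OF A]
  have X: "B * A \<in> carrier_mat n n" using Ac B by simp
  have Gc: "G \<in> carrier_mat n n" using G by (simp add: cheb4_iteration_matrix_def)
  have vec_eq: "G *\<^sub>v v = poly_mat (cheb4_p k) (B * A) *\<^sub>v v" if v: "v \<in> carrier_vec n" for v
  proof -
    have A0: "inv_mat A *\<^sub>v 0\<^sub>v n = 0\<^sub>v n"
      using spd_mat_inverse(1)[OF A] by (intro eq_vecI) auto
    have "0\<^sub>v n - (- v) = v" using v by (intro eq_vecI) auto
    then show ?thesis
      using G cheb4_iter_error[OF A B, of "0\<^sub>v n" "- v" k] v
      unfolding cheb4_iteration_matrix_def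
      by (metis A0 uminus_carrier_vec zero_carrier_vec)
  qed
  show ?thesis
    by (rule mat_eqI_mult_vec[OF Gc poly_mat_carrier[OF X] vec_eq])
qed

section \<open>The smoothing property\<close>

locale preconditioned =
  fixes n :: nat and A B :: "real mat"
  assumes A_spd: "spd_mat n A" and B_spd: "spd_mat n B"
begin

lemmas A_carrier = spd_carrier[OF A_spd] and B_carrier = spd_carrier[OF B_spd]

lemma BA_carrier: "B * A \<in> carrier_mat n n"
  using A_carrier B_carrier by simp

lemma form_BA:
  assumes "u \<in> carrier_vec n" "v \<in> carrier_vec n"
  shows "form A (B * A *\<^sub>v u) v = form B (A *\<^sub>v u) (A *\<^sub>v v)"
proof -
  have Au: "A *\<^sub>v u \<in> carrier_vec n" and Av: "A *\<^sub>v v \<in> carrier_vec n"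
    using A_carrier assms by auto
  have "form A (B * A *\<^sub>v u) v = (B *\<^sub>v (A *\<^sub>v u)) \<bullet> (A *\<^sub>v v)"
    using assoc_mult_mat_vec[OF B_carrier A_carrier assms(1)] by (simp add: form_def)
  also have "\<dots> = form B (A *\<^sub>v v) (A *\<^sub>v u)"
    unfolding form_def using B_carrier Au Av by (intro comm_scalar_prod[of _ n]) auto
  finally show ?thesis using form_commute[OF B_spd Au Av] by simp
qed

lemma BA_self_adjoint: "self_adjoint n A (B * A)"
  unfolding self_adjoint_def
proof (intro conjI ballI BA_carrier)
  fix u v :: "real vec" assume uv: "u \<in> carrier_vec n" "v \<in> carrier_vec n"
  have "B * A *\<^sub>v v \<in> carrier_vec n" using BA_carrier uv(2) by (rule mult_mat_vec_carrier)
  then show "form A (B * A *\<^sub>v u) v = form A u (B * A *\<^sub>v v)"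
    using form_BA uv form_commute[OF A_spd uv(1)] form_commute[OF B_spd, of "A *\<^sub>v u" "A *\<^sub>v v"] A_carrier
    by simp
qed

lemma BA_eigenvalue_pos:
  assumes v: "v \<in> carrier_vec n" "v \<noteq> 0\<^sub>v n" and ev: "B * A *\<^sub>v v = \<mu> \<cdot>\<^sub>v v"
  shows "0 < \<mu>"
proof -
  have "A *\<^sub>v v \<noteq> 0\<^sub>v n"
    using form_pos[OF A_spd v] v by (auto simp: form_def)
  then have "0 < form A (B * A *\<^sub>v v) v"
    using form_BA[OF v(1) v(1)] form_pos[OF B_spd, of "A *\<^sub>v v"] A_carrier v by simp
  then show ?thesis
    using form_pos[OF A_spd v] v A_carrier by (simp add: ev form_linear[of A n] zero_less_mult_iff)
qed

lemma BA_eigenvalue_le_spectral_radius: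
  assumes v: "v \<in> carrier_vec n" "v \<noteq> 0\<^sub>v n" and ev: "B * A *\<^sub>v v = \<mu> \<cdot>\<^sub>v v"
  shows "\<mu> \<le> real_spectral_radius (B * A)"
proof -
  let ?X = "map_mat complex_of_real (B * A)"
  have "eigenvector (B * A) v \<mu>" using v ev BA_carrier B_carrier by (simp add: eigenvector_def)
  then have "eigenvalue ?X (complex_of_real \<mu>)"
    using of_real_hom.eigenvector_hom[OF BA_carrier] unfolding eigenvalue_def by blast
  moreover have "0 < n" using v by (cases n) auto
  moreover have "?X \<in> carrier_mat n n" using BA_carrier by simp
  ultimately have "norm (complex_of_real \<mu>) \<le> spectral_radius ?X"
    by (intro spectral_radius_mem_max(2) imageI) (auto simp: spectrum_def)
  then show ?thesis by (simp add: real_spectral_radius_def)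
qed

lemma BA_eigenbasis:
  "\<exists>e d. orthonormal n A n e \<and>
     (\<forall>i<n. B * A *\<^sub>v e i = d i \<cdot>\<^sub>v e i \<and> 0 < d i \<and> d i \<le> real_spectral_radius (B * A))"
proof -
  obtain e d where e: "orthonormal n A n e" and ev: "\<And>i. i < n \<Longrightarrow> B * A *\<^sub>v e i = d i \<cdot>\<^sub>v e i"
    using self_adjoint_spectral[OF A_spd BA_self_adjoint] by blast
  have ec: "e i \<in> carrier_vec n" "e i \<noteq> 0\<^sub>v n" if i: "i < n" for i
  proof -
    show "e i \<in> carrier_vec n" using e i by (simp add: orthonormal_def)
    have "form A (e i) (e i) = 1" using e i by (simp add: orthonormal_def)
    then show "e i \<noteq> 0\<^sub>v n" using form_zero[OF A_carrier, of "0\<^sub>v n"] by auto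
  qed
  have "0 < d i \<and> d i \<le> real_spectral_radius (B * A)" if "i < n" for i
    using BA_eigenvalue_pos[OF ec[OF that] ev[OF that]]
      BA_eigenvalue_le_spectral_radius[OF ec[OF that] ev[OF that]] by blast
  with e ev show ?thesis by blast
qed

text \<open>In an \<open>A\<close>-orthonormal eigenbasis of \<open>B A\<close> the inequality splits into the scalar inequality at the eigenvalues, which
  lie in \<open>(0, 1]\<close>.\<close>

lemma cheb4_smoothing:
  assumes \<rho>: "real_spectral_radius (B * A) \<le> 1" and v: "v \<in> carrier_vec n"
    and y: "y = poly_mat (cheb4_p k) (B * A) *\<^sub>v v"
  shows "form A y y + 4 / 3 * real k * (real k + 1) * form B (A *\<^sub>v y) (A *\<^sub>v y) \<le> form A v v"
proof -
  obtain e d where e: "orthonormal n A n e"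
    and ed: "\<forall>i<n. B * A *\<^sub>v e i = d i \<cdot>\<^sub>v e i \<and> 0 < d i \<and> d i \<le> real_spectral_radius (B * A)"
    using BA_eigenbasis by blast
  have ev: "B * A *\<^sub>v e i = d i \<cdot>\<^sub>v e i" and d: "0 < d i" "d i \<le> real_spectral_radius (B * A)"
    if "i < n" for i using ed that by auto
  have ec: "e i \<in> carrier_vec n" if "i < n" for i using e that by (simp add: orthonormal_def)
  let ?p = "\<lambda>i. poly (cheb4_p k) (d i)" and ?c = "\<lambda>i. form A (e i) v"
  let ?\<gamma> = "4 / 3 * real k * (real k + 1)"
  have yc: "y \<in> carrier_vec n" unfolding y
    using poly_mat_carrier[OF BA_carrier] v by (rule mult_mat_vec_carrier)
  have Xy: "B * A *\<^sub>v y \<in> carrier_vec n" using BA_carrier yc by (rule mult_mat_vec_carrier)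
  have cy: "form A (e i) y = ?p i * ?c i" if i: "i < n" for i
    using self_adjointD(2)[OF self_adjoint_poly_mat[OF BA_self_adjoint A_carrier] ec[OF i] v]
      poly_mat_eigenvector[OF BA_carrier ec[OF i] ev[OF i]] ec[OF i] v A_carrier
    by (simp add: y form_linear[of A n])
  have cXy: "form A (e i) (B * A *\<^sub>v y) = d i * (?p i * ?c i)" if i: "i < n" for i
    using self_adjointD(2)[OF BA_self_adjoint ec[OF i] yc] ev[OF i] ec[OF i] yc A_carrier cy[OF i]
    by (simp add: form_linear[of A n])
  have "form A y y = (\<Sum>i<n. (?p i)\<^sup>2 * (?c i)\<^sup>2)"
    using orthonormal_Parseval[OF A_spd e yc yc] by (simp add: cy power2_eq_square mult_ac)
  moreover have "form B (A *\<^sub>v y) (A *\<^sub>v y) = (\<Sum>i<n. d i * (?p i)\<^sup>2 * (?c i)\<^sup>2)"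
    using orthonormal_Parseval[OF A_spd e Xy yc] form_BA[OF yc yc]
    by (simp add: cy cXy power2_eq_square mult_ac)
  ultimately have "form A y y + ?\<gamma> * form B (A *\<^sub>v y) (A *\<^sub>v y)
      = (\<Sum>i<n. ((?p i)\<^sup>2 * (1 + ?\<gamma> * d i)) * (?c i)\<^sup>2)"
  proof (simp only: sum_distrib_left sum.distrib[symmetric], intro sum.cong refl)
    show "(?p i)\<^sup>2 * (?c i)\<^sup>2 + ?\<gamma> * (d i * (?p i)\<^sup>2 * (?c i)\<^sup>2) = ((?p i)\<^sup>2 * (1 + ?\<gamma> * d i)) * (?c i)\<^sup>2" for i
      by (simp add: distrib_left distrib_right mult_ac)
  qed
  also have "\<dots> \<le> (\<Sum>i<n. 1 * (?c i)\<^sup>2)"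
  proof (intro sum_mono mult_right_mono)
    fix i assume "i \<in> {..<n}"
    then show "(?p i)\<^sup>2 * (1 + ?\<gamma> * d i) \<le> 1"
      using d[of i] \<rho> by (intro cheb4_p_square_weighted_le_1) auto
  qed simp
  also have "\<dots> = form A v v"
    using orthonormal_Parseval[OF A_spd e v v] by (simp add: power2_eq_square)
  finally show ?thesis .
qed

text \<open>The energy of an error is controlled by its residual \<open>A y\<close> in the \<open>B\<close>-norm, with a constant that only
  has to be finite: it guarantees that the supremum in \<^const>\<open>approx_const\<close> is taken over a bounded set.\<close>

lemma energy_le_residual:
  "\<exists>D \<ge> 0. \<forall>y \<in> carrier_vec n. form A y y \<le> D * form B (A *\<^sub>v y) (A *\<^sub>v y)"
proof -
  obtain e d where e: "orthonormal n A n e"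
    and ed: "\<forall>i<n. B * A *\<^sub>v e i = d i \<cdot>\<^sub>v e i \<and> 0 < d i \<and> d i \<le> real_spectral_radius (B * A)"
    using BA_eigenbasis by blast
  have ev: "B * A *\<^sub>v e i = d i \<cdot>\<^sub>v e i" and d: "0 < d i" if "i < n" for i
    using ed that by auto
  have ec: "e i \<in> carrier_vec n" if "i < n" for i using e that by (simp add: orthonormal_def)
  define D where "D = (\<Sum>i<n. 1 / d i)"
  show ?thesis
  proof (intro exI[of _ D] conjI ballI)
    show "0 \<le> D" using d by (auto simp: D_def less_imp_le intro!: sum_nonneg)
    fix y :: "real vec" assume y: "y \<in> carrier_vec n"
    let ?c = "\<lambda>i. form A (e i) y"
    have Xy: "B * A *\<^sub>v y \<in> carrier_vec n" using BA_carrier y by (rule mult_mat_vec_carrier)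
    have cXy: "form A (e i) (B * A *\<^sub>v y) = d i * ?c i" if i: "i < n" for i
      using self_adjointD(2)[OF BA_self_adjoint ec[OF i] y] ev[OF i] ec[OF i] y A_carrier
      by (simp add: form_linear[of A n])
    have "form A y y = (\<Sum>i<n. (1 / d i) * (d i * (?c i)\<^sup>2))"
      using orthonormal_Parseval[OF A_spd e y y] d by (simp add: power2_eq_square less_imp_neq[THEN not_sym])
    also have "\<dots> \<le> (\<Sum>i<n. D * (d i * (?c i)\<^sup>2))"
    proof (intro sum_mono mult_right_mono)
      fix i assume i: "i \<in> {..<n}"
      then show "1 / d i \<le> D"
        unfolding D_def using d by (intro member_le_sum) (auto simp: less_imp_le)
      show "0 \<le> d i * (?c i)\<^sup>2" using d i by (simp add: less_imp_le)
    qed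
    also have "\<dots> = D * form B (A *\<^sub>v y) (A *\<^sub>v y)"
      using orthonormal_Parseval[OF A_spd e Xy y] form_BA[OF y y]
      by (simp add: cXy sum_distrib_left power2_eq_square mult_ac)
    finally show "form A y y \<le> D * form B (A *\<^sub>v y) (A *\<^sub>v y)" .
  qed
qed

end

section \<open>Two levels\<close>

lemma vec_norm_wrt_form: "vec_norm_wrt S v = sqrt (form S v v)"
  by (simp add: vec_norm_wrt_def form_def)

lemma form_galerkin:
  assumes A: "A \<in> carrier_mat n n" and P: "P \<in> carrier_mat n m"
    and a: "a \<in> carrier_vec m" and b: "b \<in> carrier_vec m"
  shows "form (P\<^sup>T * A * P) a b = form A (P *\<^sub>v a) (P *\<^sub>v b)"
proof -
  have Pa: "P *\<^sub>v a \<in> carrier_vec n" and w: "A *\<^sub>v (P *\<^sub>v b) \<in> carrier_vec n"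
    using P A a b by auto
  have PT: "P\<^sup>T \<in> carrier_mat m n" and PTA: "P\<^sup>T * A \<in> carrier_mat m n" using P A by auto
  have Pb: "P *\<^sub>v b \<in> carrier_vec n" using P b by simp
  have "(P\<^sup>T * A * P) *\<^sub>v b = P\<^sup>T *\<^sub>v (A *\<^sub>v (P *\<^sub>v b))"
    unfolding assoc_mult_mat_vec[OF PTA P b] assoc_mult_mat_vec[OF PT A Pb] ..
  then have "form (P\<^sup>T * A * P) a b = (P\<^sup>T *\<^sub>v (A *\<^sub>v (P *\<^sub>v b))) \<bullet> a"
    unfolding form_def using a PT w by (auto intro: comm_scalar_prod[of _ m])
  also have "\<dots> = (A *\<^sub>v (P *\<^sub>v b)) \<bullet> (P *\<^sub>v a)" by (rule transpose_vec_mult_scalar[OF P a w])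
  also have "\<dots> = form A (P *\<^sub>v a) (P *\<^sub>v b)"
    unfolding form_def by (rule comm_scalar_prod[OF w Pa])
  finally show ?thesis .
qed

lemma galerkin_spd:
  assumes A: "spd_mat n A" and P: "P \<in> carrier_mat n m"
    and inj: "inj_on (\<lambda>v. P *\<^sub>v v) (carrier_vec m)"
  shows "spd_mat m (P\<^sup>T * A * P)"
  unfolding spd_mat_def
proof (intro conjI ballI impI)
  note Ac = spd_carrier[OF A]
  have PT: "P\<^sup>T \<in> carrier_mat m n" using P by simp
  show "P\<^sup>T * A * P \<in> carrier_mat m m" using Ac P by auto
  have "(P\<^sup>T * A * P)\<^sup>T = P\<^sup>T * (P\<^sup>T * A)\<^sup>T"
    using Ac PT P by (intro transpose_mult) auto
  also have "(P\<^sup>T * A)\<^sup>T = A\<^sup>T * (P\<^sup>T)\<^sup>T" by (rule transpose_mult[OF PT Ac])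
  also have "\<dots> = A * P" using A by (simp add: spd_mat_def)
  also have "P\<^sup>T * (A * P) = P\<^sup>T * A * P" using assoc_mult_mat[OF PT Ac P] ..
  finally show "(P\<^sup>T * A * P)\<^sup>T = P\<^sup>T * A * P" .
  fix v :: "real vec" assume v: "v \<in> carrier_vec m" "v \<noteq> 0\<^sub>v m"
  have "P *\<^sub>v 0\<^sub>v m = 0\<^sub>v n" using P by (intro eq_vecI) auto
  then have "P *\<^sub>v v \<noteq> 0\<^sub>v n" using inj_onD[OF inj, of v "0\<^sub>v m"] v by auto
  then have "0 < form A (P *\<^sub>v v) (P *\<^sub>v v)" using P v by (intro form_pos[OF A]) auto
  then show "0 < v \<bullet> (P\<^sup>T * A * P *\<^sub>v v)"
    using form_galerkin[OF Ac P v(1) v(1)] by (simp add: form_def)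
qed

text \<open>This says that the operator norm of \<open>T\<close> in the energy norm is at most \<open>\<surd>\<delta>\<close>. The bilinear form of the condition
  treats \<open>T\<close> and its adjoint alike, so that the smoother can be moved to the second argument without ever
  introducing adjoints.\<close>

definition energy_bound :: "nat \<Rightarrow> real mat \<Rightarrow> real \<Rightarrow> real mat \<Rightarrow> bool" where
  "energy_bound n S \<delta> T \<longleftrightarrow>
     (\<forall>u \<in> carrier_vec n. \<forall>v \<in> carrier_vec n. (form S (T *\<^sub>v u) v)\<^sup>2 \<le> \<delta> * form S u u * form S v v)"

locale two_level = preconditioned +
  fixes m :: nat and P :: "real mat"
  assumes P_carrier: "P \<in> carrier_mat n m"
    and P_inj: "inj_on (\<lambda>v. P *\<^sub>v v) (carrier_vec m)"
begin

definition Ac :: "real mat" where "Ac = P\<^sup>T * A * P"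

lemma Ac_spd: "spd_mat m Ac"
  unfolding Ac_def by (rule galerkin_spd[OF A_spd P_carrier P_inj])

lemmas Ac_carrier = spd_carrier[OF Ac_spd]

lemma PT_carrier: "P\<^sup>T \<in> carrier_mat m n"
  using P_carrier by simp

text \<open>\<open>P *\<^sub>v coarse_part u\<close> is the \<open>A\<close>-orthogonal projection of \<open>u\<close> onto the range of \<open>P\<close>; the energy splits
  orthogonally into that of the coarse part and that of the fine part.\<close>

definition coarse_part :: "real vec \<Rightarrow> real vec" where
  "coarse_part u = inv_mat Ac *\<^sub>v (P\<^sup>T *\<^sub>v (A *\<^sub>v u))"

definition fine_part :: "real vec \<Rightarrow> real vec" where
  "fine_part u = u - P *\<^sub>v coarse_part u"

lemma
  assumes "u \<in> carrier_vec n"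
  shows coarse_part_carrier: "coarse_part u \<in> carrier_vec m"
    and Ac_coarse_part: "Ac *\<^sub>v coarse_part u = P\<^sup>T *\<^sub>v (A *\<^sub>v u)"
    and P_coarse_part_carrier: "P *\<^sub>v coarse_part u \<in> carrier_vec n"
    and fine_part_carrier: "fine_part u \<in> carrier_vec n"
proof -
  have "P\<^sup>T *\<^sub>v (A *\<^sub>v u) \<in> carrier_vec m"
    using PT_carrier A_carrier assms by (metis mult_mat_vec_carrier)
  from spd_mat_inverse_vec[OF Ac_spd this]
  show c: "coarse_part u \<in> carrier_vec m" and "Ac *\<^sub>v coarse_part u = P\<^sup>T *\<^sub>v (A *\<^sub>v u)"
    by (simp_all add: coarse_part_def)
  show "P *\<^sub>v coarse_part u \<in> carrier_vec n" using P_carrier c by (rule mult_mat_vec_carrier)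
  then show "fine_part u \<in> carrier_vec n" using assms by (simp add: fine_part_def)
qed

lemma form_prolong_left:
  assumes a: "a \<in> carrier_vec m" and v: "v \<in> carrier_vec n"
  shows "form A (P *\<^sub>v a) v = form Ac a (coarse_part v)"
proof -
  have Av: "A *\<^sub>v v \<in> carrier_vec n" using A_carrier v by (rule mult_mat_vec_carrier)
  have "form A (P *\<^sub>v a) v = (A *\<^sub>v v) \<bullet> (P *\<^sub>v a)"
    unfolding form_def using P_carrier a Av by (auto intro: comm_scalar_prod[of _ n])
  also have "\<dots> = (P\<^sup>T *\<^sub>v (A *\<^sub>v v)) \<bullet> a"
    using transpose_vec_mult_scalar[OF P_carrier a Av] ..
  also have "\<dots> = form Ac a (coarse_part v)"
    unfolding form_def Ac_coarse_part[OF v]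
    using mult_mat_vec_carrier[OF PT_carrier Av] a by (rule comm_scalar_prod)
  finally show ?thesis .
qed

lemma form_fine_part:
  assumes u: "u \<in> carrier_vec n" and v: "v \<in> carrier_vec n"
  shows "form A (fine_part u) (fine_part v) = form A u v - form Ac (coarse_part u) (coarse_part v)"
proof -
  note c = coarse_part_carrier P_coarse_part_carrier
  have "form A u (P *\<^sub>v coarse_part v) = form Ac (coarse_part u) (coarse_part v)"
    using form_prolong_left[OF c(1)[OF v] u] form_commute[OF A_spd u c(2)[OF v]]
      form_commute[OF Ac_spd c(1)[OF u] c(1)[OF v]] by simp
  moreover have "form A (P *\<^sub>v coarse_part u) (P *\<^sub>v coarse_part v)
      = form Ac (coarse_part u) (coarse_part v)"
    unfolding Ac_def by (rule form_galerkin[OF A_carrier P_carrier c(1)[OF u] c(1)[OF v], symmetric])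
  ultimately show ?thesis
    unfolding fine_part_def
    using form_prolong_left[OF c(1)[OF u] v] c(2)[OF u] c(2)[OF v] u v A_carrier
    by (simp add: form_linear[of A n])
qed

text \<open>The operator in the approximation property, applied to a residual \<open>A y\<close>, gives the part of \<open>y\<close> that the
  exact coarse correction cannot see.\<close>

lemma approx_operator:
  assumes y: "y \<in> carrier_vec n"
  shows "(inv_mat A - P * inv_mat Ac * P\<^sup>T) *\<^sub>v (A *\<^sub>v y) = fine_part y"
proof -
  have Ay: "A *\<^sub>v y \<in> carrier_vec n" using A_carrier y by (rule mult_mat_vec_carrier)
  note iA = spd_mat_inverse(1)[OF A_spd] and iAc = spd_mat_inverse(1)[OF Ac_spd]
  have PiAc: "P * inv_mat Ac \<in> carrier_mat n m" using P_carrier iAc by (rule mult_carrier_mat)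
  have PiAcPT: "P * inv_mat Ac * P\<^sup>T \<in> carrier_mat n n" using PiAc PT_carrier by (rule mult_carrier_mat)
  have w: "P\<^sup>T *\<^sub>v (A *\<^sub>v y) \<in> carrier_vec m" using PT_carrier Ay by (rule mult_mat_vec_carrier)
  show ?thesis
    unfolding minus_mult_distrib_mat_vec[OF iA PiAcPT Ay] spd_mat_inverse_vec(3)[OF A_spd y]
      assoc_mult_mat_vec[OF PiAc PT_carrier Ay] assoc_mult_mat_vec[OF P_carrier iAc w]
    by (simp add: fine_part_def coarse_part_def)
qed

text \<open>The constant is a supremum over a bounded set that contains \<open>0\<close>; the inequality for general \<open>y\<close>
  follows from scaling the residual \<open>A y\<close> to unit \<open>B\<close>-norm.\<close>

lemma approx_property:
  shows approx_const_nonneg: "0 \<le> approx_const A Ac P B"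
    and fine_part_le_approx_const: "y \<in> carrier_vec n \<Longrightarrow>
      form A (fine_part y) (fine_part y) \<le> approx_const A Ac P B * form B (A *\<^sub>v y) (A *\<^sub>v y)"
proof -
  define F where "F = {f \<in> carrier_vec n. vec_norm_wrt B f \<le> 1}"
  define q where "q f = (vec_norm_wrt A ((inv_mat A - P * inv_mat Ac * P\<^sup>T) *\<^sub>v f))\<^sup>2" for f
  have C: "approx_const A Ac P B = (SUP f \<in> F. q f)"
    using A_carrier by (simp add: approx_const_def F_def q_def)
  have q_Ay: "q (A *\<^sub>v y) = form A (fine_part y) (fine_part y)" if "y \<in> carrier_vec n" for y
    using approx_operator[OF that] form_nonneg[OF A_spd fine_part_carrier[OF that]]
    by (simp add: q_def vec_norm_wrt_form)
  have fine_le: "form A (fine_part y) (fine_part y) \<le> form A y y" if y: "y \<in> carrier_vec n" for y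
    using form_fine_part[OF y y] form_nonneg[OF Ac_spd coarse_part_carrier[OF y]] by simp
  obtain D where D: "0 \<le> D" "\<And>y. y \<in> carrier_vec n \<Longrightarrow> form A y y \<le> D * form B (A *\<^sub>v y) (A *\<^sub>v y)"
    using energy_le_residual by blast
  have "q f \<le> D" if f: "f \<in> F" for f
  proof -
    have fc: "f \<in> carrier_vec n" and f1: "form B f f \<le> 1"
      using f form_nonneg[OF B_spd, of f] by (auto simp: F_def vec_norm_wrt_form)
    define y where "y = inv_mat A *\<^sub>v f"
    have y: "y \<in> carrier_vec n" "A *\<^sub>v y = f"
      using spd_mat_inverse_vec[OF A_spd fc] by (auto simp: y_def)
    have "q f \<le> D * form B f f" using q_Ay[OF y(1)] fine_le[OF y(1)] D(2)[OF y(1)] y(2) by simp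
    also have "\<dots> \<le> D" using f1 D(1) by (simp add: mult_left_le)
    finally show ?thesis .
  qed
  then have bdd: "bdd_above (q ` F)" by (intro bdd_aboveI[of _ D]) auto
  have "0\<^sub>v n \<in> F" using form_zero[OF B_carrier, of "0\<^sub>v n"] by (simp add: F_def vec_norm_wrt_form)
  then have "q (0\<^sub>v n) \<le> approx_const A Ac P B" unfolding C by (rule cSUP_upper[OF _ bdd])
  then show nonneg: "0 \<le> approx_const A Ac P B" by (rule order_trans[rotated]) (simp add: q_def)
  assume y: "y \<in> carrier_vec n"
  have Ay: "A *\<^sub>v y \<in> carrier_vec n" using A_carrier y by (rule mult_mat_vec_carrier)
  show "form A (fine_part y) (fine_part y) \<le> approx_const A Ac P B * form B (A *\<^sub>v y) (A *\<^sub>v y)"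
  proof (cases "A *\<^sub>v y = 0\<^sub>v n")
    case True
    then have "form A y y = 0" using y by (simp add: form_def)
    then show ?thesis
      using fine_le[OF y] True form_zero[OF B_carrier, of "0\<^sub>v n"] by simp
  next
    case False
    define \<beta> where "\<beta> = form B (A *\<^sub>v y) (A *\<^sub>v y)"
    have \<beta>: "0 < \<beta>" unfolding \<beta>_def using B_spd Ay False by (rule form_pos)
    define c where "c = 1 / sqrt \<beta>"
    have c2: "c * c = 1 / \<beta>" using \<beta> by (simp add: c_def)
    have cy: "c \<cdot>\<^sub>v y \<in> carrier_vec n" "A *\<^sub>v (c \<cdot>\<^sub>v y) = c \<cdot>\<^sub>v (A *\<^sub>v y)"
      using y mult_mat_vec[OF A_carrier y] by auto
    have "form B (c \<cdot>\<^sub>v (A *\<^sub>v y)) (c \<cdot>\<^sub>v (A *\<^sub>v y)) = c * c * \<beta>"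
      using Ay B_carrier by (simp add: form_linear[of B n] \<beta>_def)
    then have "c \<cdot>\<^sub>v (A *\<^sub>v y) \<in> F"
      using Ay \<beta> c2 by (simp add: F_def vec_norm_wrt_form)
    then have "q (c \<cdot>\<^sub>v (A *\<^sub>v y)) \<le> approx_const A Ac P B"
      unfolding C by (rule cSUP_upper[OF _ bdd])
    moreover have "q (c \<cdot>\<^sub>v (A *\<^sub>v y)) = c * c * form A (fine_part y) (fine_part y)"
    proof -
      have iA: "inv_mat A - P * inv_mat Ac * P\<^sup>T \<in> carrier_mat n n"
        using spd_mat_inverse(1)[OF Ac_spd] P_carrier by (intro minus_carrier_mat) auto
      have "(inv_mat A - P * inv_mat Ac * P\<^sup>T) *\<^sub>v (c \<cdot>\<^sub>v (A *\<^sub>v y)) = c \<cdot>\<^sub>v fine_part y"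
        unfolding mult_mat_vec[OF iA Ay] approx_operator[OF y] ..
      then show ?thesis
        using form_nonneg[OF A_spd, of "c \<cdot>\<^sub>v fine_part y"] fine_part_carrier[OF y] A_carrier
        by (simp add: q_def vec_norm_wrt_form form_linear[of A n])
    qed
    ultimately show ?thesis
      using \<beta> by (simp add: c2 \<beta>_def[symmetric] divide_le_eq)
  qed
qed

text \<open>An inexact coarse solve leaves the fine part alone and acts on the coarse part by its own error matrix.\<close>

lemma form_coarse_correction:
  assumes Mc: "Mc \<in> carrier_mat m m" and u: "u \<in> carrier_vec n" and y: "y \<in> carrier_vec n"
  shows "form A ((1\<^sub>m n - P * Mc * P\<^sup>T * A) *\<^sub>v u) y
    = form A (fine_part u) (fine_part y)
      + form Ac ((1\<^sub>m m - Mc * Ac) *\<^sub>v coarse_part u) (coarse_part y)"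
proof -
  note cu = coarse_part_carrier[OF u] and cy = coarse_part_carrier[OF y]
  have Au: "A *\<^sub>v u \<in> carrier_vec n" using A_carrier u by (rule mult_mat_vec_carrier)
  have w: "P\<^sup>T *\<^sub>v (A *\<^sub>v u) \<in> carrier_vec m" using PT_carrier Au by (rule mult_mat_vec_carrier)
  have PM: "P * Mc \<in> carrier_mat n m" using P_carrier Mc by (rule mult_carrier_mat)
  have PMP: "P * Mc * P\<^sup>T \<in> carrier_mat n n" using PM PT_carrier by (rule mult_carrier_mat)
  have PMPA: "P * Mc * P\<^sup>T * A \<in> carrier_mat n n" using PMP A_carrier by (rule mult_carrier_mat)
  have MA: "Mc * Ac \<in> carrier_mat m m" using Mc Ac_carrier by (rule mult_carrier_mat)
  define z where "z = Mc *\<^sub>v (Ac *\<^sub>v coarse_part u)"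
  have z: "z \<in> carrier_vec m" using Mc Ac_carrier cu unfolding z_def by (metis mult_mat_vec_carrier)
  have Pz: "P *\<^sub>v z \<in> carrier_vec n" using P_carrier z by (rule mult_mat_vec_carrier)
  have "(1\<^sub>m n - P * Mc * P\<^sup>T * A) *\<^sub>v u = u - P *\<^sub>v z"
    unfolding minus_mult_distrib_mat_vec[OF one_carrier_mat PMPA u] one_mult_mat_vec[OF u]
      assoc_mult_mat_vec[OF PMP A_carrier u] assoc_mult_mat_vec[OF PM PT_carrier Au]
      assoc_mult_mat_vec[OF P_carrier Mc w] z_def Ac_coarse_part[OF u] ..
  then have "form A ((1\<^sub>m n - P * Mc * P\<^sup>T * A) *\<^sub>v u) y = form A u y - form Ac z (coarse_part y)"
    using form_minus_left[OF A_carrier u Pz y] form_prolong_left[OF z y] by simp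
  moreover have "(1\<^sub>m m - Mc * Ac) *\<^sub>v coarse_part u = coarse_part u - z"
    unfolding minus_mult_distrib_mat_vec[OF one_carrier_mat MA cu] one_mult_mat_vec[OF cu]
      assoc_mult_mat_vec[OF Mc Ac_carrier cu] z_def ..
  ultimately show ?thesis
    using form_minus_left[OF Ac_carrier cu z cy] form_fine_part[OF u y] by simp
qed

text \<open>With \<open>y = G v\<close> one has \<open>\<langle>G K u, v\<rangle> = \<langle>K u, y\<rangle>\<close>, and splitting into fine and coarse parts and applying
  Cauchy-Schwarz bounds its square by \<open>\<parallel>u\<parallel>\<^sup>2 (\<parallel>y\<^sub>f\<parallel>\<^sup>2 + \<delta> \<parallel>y\<^sub>c\<parallel>\<^sup>2) = \<parallel>u\<parallel>\<^sup>2 ((1 - \<delta>) \<parallel>y\<^sub>f\<parallel>\<^sup>2 + \<delta> \<parallel>y\<parallel>\<^sup>2)\<close>.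
  The approximation property bounds \<open>\<parallel>y\<^sub>f\<parallel>\<^sup>2\<close> by \<open>C \<parallel>A y\<parallel>\<^sub>B\<^sup>2\<close>. The condition on \<open>\<delta>\<close>
  is equivalent to \<open>(1 - \<delta>) C \<le> \<delta> \<gamma>\<close> with \<open>\<gamma> = 4/3 k (k + 1)\<close>, and what remains is the smoothing inequality.\<close>

lemma energy_bound_step:
  assumes Mc: "Mc \<in> carrier_mat m m"
    and coarse: "energy_bound m Ac \<delta> (1\<^sub>m m - Mc * Ac)"
    and \<rho>: "real_spectral_radius (B * A) \<le> 1"
    and \<delta>: "0 \<le> \<delta>" "\<delta> \<le> 1"
      "approx_const A Ac P B \<le> \<delta> * (approx_const A Ac P B + 4 / 3 * real k * (real k + 1))"
  shows "energy_bound n A \<delta> (poly_mat (cheb4_p k) (B * A) * (1\<^sub>m n - P * Mc * P\<^sup>T * A))"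
  unfolding energy_bound_def
proof (intro ballI)
  fix u v :: "real vec" assume u: "u \<in> carrier_vec n" and v: "v \<in> carrier_vec n"
  let ?G = "poly_mat (cheb4_p k) (B * A)" and ?K = "1\<^sub>m n - P * Mc * P\<^sup>T * A"
  let ?C = "approx_const A Ac P B" and ?\<gamma> = "4 / 3 * real k * (real k + 1)"
  define y where "y = ?G *\<^sub>v v"
  have Gc: "?G \<in> carrier_mat n n" using BA_carrier by simp
  have yc: "y \<in> carrier_vec n" unfolding y_def using Gc v by (rule mult_mat_vec_carrier)
  have Kc: "?K \<in> carrier_mat n n" using A_carrier P_carrier by (intro minus_carrier_mat) auto
  have Ku: "?K *\<^sub>v u \<in> carrier_vec n" using Kc u by (rule mult_mat_vec_carrier)
  note cu = coarse_part_carrier[OF u] and cy = coarse_part_carrier[OF yc]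
  note fu = fine_part_carrier[OF u] and fy = fine_part_carrier[OF yc]
  define s where "s = form A (fine_part u) (fine_part y)"
  define t where "t = form Ac ((1\<^sub>m m - Mc * Ac) *\<^sub>v coarse_part u) (coarse_part y)"
  define a1 where "a1 = form A (fine_part u) (fine_part u)"
  define a2 where "a2 = form Ac (coarse_part u) (coarse_part u)"
  define b1 where "b1 = form A (fine_part y) (fine_part y)"
  define b2 where "b2 = form Ac (coarse_part y) (coarse_part y)"
  define r where "r = form B (A *\<^sub>v y) (A *\<^sub>v y)"
  have nn: "0 \<le> a1" "0 \<le> a2" "0 \<le> b1" "0 \<le> b2"
    unfolding a1_def a2_def b1_def b2_def
    using form_nonneg[OF A_spd] form_nonneg[OF Ac_spd] cu cy fu fy by auto
  have r: "0 \<le> r" unfolding r_def using A_carrier yc by (intro form_nonneg[OF B_spd]) auto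
  have uu: "form A u u = a1 + a2" and yy: "form A y y = b1 + b2"
    using form_fine_part[OF u u] form_fine_part[OF yc yc] by (simp_all add: a1_def a2_def b1_def b2_def)
  have "form A (?G * ?K *\<^sub>v u) v = form A (?K *\<^sub>v u) y"
    unfolding assoc_mult_mat_vec[OF Gc Kc u] y_def
    using self_adjointD(2)[OF self_adjoint_poly_mat[OF BA_self_adjoint A_carrier] Ku v] .
  also have "\<dots> = s + t"
    unfolding s_def t_def by (rule form_coarse_correction[OF Mc u yc])
  finally have st: "form A (?G * ?K *\<^sub>v u) v = s + t" .
  have s2: "s\<^sup>2 \<le> a1 * b1"
    unfolding s_def a1_def b1_def by (rule form_Cauchy_Schwarz[OF A_spd fu fy])
  have t2: "t\<^sup>2 \<le> a2 * (\<delta> * b2)"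
    using coarse cu cy unfolding energy_bound_def t_def a2_def b2_def by (simp add: mult_ac)
  have mixed: "(s + t)\<^sup>2 \<le> (a1 + a2) * (b1 + \<delta> * b2)"
  proof -
    have "(2 * s * t)\<^sup>2 = 4 * (s\<^sup>2 * t\<^sup>2)" by (simp add: power_mult_distrib)
    also have "\<dots> \<le> 4 * ((a1 * b1) * (a2 * (\<delta> * b2)))"
      using mult_mono[OF s2 t2] nn by simp
    also have "\<dots> \<le> (a1 * (\<delta> * b2) + a2 * b1)\<^sup>2"
      using zero_le_power2[of "a1 * (\<delta> * b2) - a2 * b1"] by (simp add: power2_eq_square algebra_simps)
    finally have sq: "(2 * s * t)\<^sup>2 \<le> (a1 * (\<delta> * b2) + a2 * b1)\<^sup>2" .
    have "2 * s * t \<le> a1 * (\<delta> * b2) + a2 * b1"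
      by (rule power2_le_imp_le[OF sq]) (use nn \<delta> in simp)
    moreover have "(s + t)\<^sup>2 = s\<^sup>2 + t\<^sup>2 + 2 * s * t" by (rule power2_sum)
    moreover have "(a1 + a2) * (b1 + \<delta> * b2) = a1 * b1 + a2 * (\<delta> * b2) + (a1 * (\<delta> * b2) + a2 * b1)"
      by (simp only: distrib_left distrib_right add_ac)
    ultimately show ?thesis using s2 t2 by linarith
  qed
  have "b1 + \<delta> * b2 \<le> \<delta> * form A v v"
  proof -
    have "(1 - \<delta>) * b1 \<le> (1 - \<delta>) * (?C * r)"
      unfolding b1_def r_def using \<delta> fine_part_le_approx_const[OF yc] by (intro mult_left_mono) auto
    also have "\<dots> = ((1 - \<delta>) * ?C) * r" by simp
    also have "\<dots> \<le> (\<delta> * ?\<gamma>) * r"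
    proof (rule mult_right_mono[OF _ r])
      show "(1 - \<delta>) * ?C \<le> \<delta> * ?\<gamma>"
        using \<delta>(3) by (simp only: left_diff_distrib distrib_left mult_1_left)
    qed
    finally have "(1 - \<delta>) * b1 \<le> \<delta> * ?\<gamma> * r" .
    moreover have "b1 + \<delta> * b2 = (1 - \<delta>) * b1 + \<delta> * (b1 + b2)" by (simp add: algebra_simps)
    ultimately have "b1 + \<delta> * b2 \<le> \<delta> * ?\<gamma> * r + \<delta> * form A y y"
      unfolding yy by linarith
    also have "\<dots> = \<delta> * (form A y y + ?\<gamma> * r)"
    proof -
      have "a * b * c + a * d = a * (d + b * c)" for a b c d :: real by (simp add: algebra_simps)
      then show ?thesis .
    qed
    also have "\<dots> \<le> \<delta> * form A v v"
      using cheb4_smoothing[OF \<rho> v y_def] \<delta>(1) unfolding r_def by (intro mult_left_mono) auto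
    finally show ?thesis .
  qed
  then have "(a1 + a2) * (b1 + \<delta> * b2) \<le> (a1 + a2) * (\<delta> * form A v v)"
    using nn by (intro mult_left_mono) auto
  with mixed have "(s + t)\<^sup>2 \<le> (a1 + a2) * (\<delta> * form A v v)" by (rule order_trans)
  then show "(form A (?G * ?K *\<^sub>v u) v)\<^sup>2 \<le> \<delta> * form A u u * form A v v"
    unfolding st uu by (simp add: mult_ac)
qed

end

lemma op_norm_wrt_le:
  assumes S: "spd_mat n S" and n: "0 < n" and T: "T \<in> carrier_mat n n"
    and bnd: "energy_bound n S \<delta> T" and \<delta>: "0 \<le> \<delta>"
  shows "(op_norm_wrt S T)\<^sup>2 \<le> \<delta>"
proof -
  define U where "U = {v \<in> carrier_vec n. v \<noteq> (0\<^sub>v n :: real vec)}"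
  define q where "q v = vec_norm_wrt S (T *\<^sub>v v) / vec_norm_wrt S v" for v
  have op: "op_norm_wrt S T = (SUP v \<in> U. q v)"
    using spd_carrier[OF S] by (simp add: op_norm_wrt_def U_def q_def)
  have q: "0 \<le> q v" "q v \<le> sqrt \<delta>" if "v \<in> U" for v
  proof -
    have v: "v \<in> carrier_vec n" "v \<noteq> 0\<^sub>v n" using that by (auto simp: U_def)
    have Tv: "T *\<^sub>v v \<in> carrier_vec n" using T v by simp
    have pos: "0 < form S v v" by (rule form_pos[OF S v])
    have nn: "0 \<le> form S (T *\<^sub>v v) (T *\<^sub>v v)" by (rule form_nonneg[OF S Tv])
    show "0 \<le> q v" using pos nn by (simp add: q_def vec_norm_wrt_form)
    have "(form S (T *\<^sub>v v) (T *\<^sub>v v))\<^sup>2 \<le> \<delta> * form S v v * form S (T *\<^sub>v v) (T *\<^sub>v v)"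
      using bnd v Tv by (simp add: energy_bound_def)
    then have "form S (T *\<^sub>v v) (T *\<^sub>v v) \<le> \<delta> * form S v v"
      using nn pos \<delta> by (cases "form S (T *\<^sub>v v) (T *\<^sub>v v) = 0") (auto simp: power2_eq_square)
    then show "q v \<le> sqrt \<delta>"
      using pos by (simp add: q_def vec_norm_wrt_form real_sqrt_divide[symmetric] divide_le_eq)
  qed
  have "unit_vec n 0 \<in> U" using n unit_vec_nonzero[of n 0] by (simp add: U_def)
  then have ne: "U \<noteq> {}" by blast
  have "bdd_above (q ` U)" using q(2) by (intro bdd_aboveI[of _ "sqrt \<delta>"]) auto
  then have "q (unit_vec n 0) \<le> op_norm_wrt S T"
    unfolding op by (rule cSUP_upper[OF \<open>unit_vec n 0 \<in> U\<close>])
  then have "0 \<le> op_norm_wrt S T" using q(1)[OF \<open>unit_vec n 0 \<in> U\<close>] by linarith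
  moreover have "op_norm_wrt S T \<le> sqrt \<delta>"
    unfolding op using ne q by (intro cSUP_least) auto
  ultimately show ?thesis using \<delta> power_mono[of "op_norm_wrt S T" "sqrt \<delta>" 2] by simp
qed

section \<open>The multilevel bound\<close>

theorem corollary3p4:
  fixes L k :: nat
    and n :: "nat \<Rightarrow> nat"
    and A P B G M K E :: "nat \<Rightarrow> real mat"
    and C :: "nat \<Rightarrow> real"
  assumes L: "L \<ge> 1" and k: "k \<ge> 1"
    and A_finest: "spd_mat (n L) (A L)"
    and dims: "\<And>l. l \<in> {1..L} \<Longrightarrow> n (l - 1) < n l"
    and P_carrier: "\<And>l. l \<in> {1..L} \<Longrightarrow> P l \<in> carrier_mat (n l) (n (l - 1))"
    and P_inj: "\<And>l. l \<in> {1..L} \<Longrightarrow> inj_on (\<lambda>v. P l *\<^sub>v v) (carrier_vec (n (l - 1)))"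
    and galerkin: "\<And>l. l \<in> {1..L} \<Longrightarrow> A (l - 1) = (P l)\<^sup>T * A l * P l"
    and B_spd: "\<And>l. l \<in> {1..L} \<Longrightarrow> spd_mat (n l) (B l)"
    and B_scaled: "\<And>l. l \<in> {1..L} \<Longrightarrow> real_spectral_radius (B l * A l) \<le> 1"
    and smoother: "\<And>l. l \<in> {1..L} \<Longrightarrow> cheb4_iteration_matrix (n l) k (A l) (B l) (G l)"
    and M_coarsest: "M 0 = inv_mat (A 0)"
    and M_carrier: "\<And>l. l \<in> {1..L} \<Longrightarrow> M l \<in> carrier_mat (n l) (n l)"
    and K_def: "\<And>l. l \<in> {1..L} \<Longrightarrow> K l = 1\<^sub>m (n l) - P l * M (l - 1) * (P l)\<^sup>T * A l"
    and E_def: "\<And>l. l \<in> {1..L} \<Longrightarrow> E l = 1\<^sub>m (n l) - M l * A l"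
    and half_V_cycle: "\<And>l. l \<in> {1..L} \<Longrightarrow> E l = G l * K l"
    and C_def: "\<And>l. l \<in> {1..L} \<Longrightarrow> C l = approx_const (A l) (A (l - 1)) (P l) (B l)"
  shows "(\<forall>l \<in> {1..L}. G l = poly_mat (cheb4_p k) (B l * A l)) \<and>
    (op_norm_wrt (A L) (E L))\<^sup>2
      \<le> (MAX l \<in> {1..L}. C l / (C l + 4 / 3 * real k * (real k + 1)))"
proof -
  define \<gamma> where "\<gamma> = 4 / 3 * real k * (real k + 1)"
  have \<gamma>: "0 < \<gamma>" using k by (simp add: \<gamma>_def)
  define \<delta> where "\<delta> = (MAX l \<in> {1..L}. C l / (C l + \<gamma>))"
  have A_spd: "spd_mat (n l) (A l)" if "l \<le> L" for l
    using that
  proof (induction rule: inc_induct)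
    case (step l)
    have l: "Suc l \<in> {1..L}" using step.hyps by auto
    show ?case
      using galerkin_spd[OF step.IH P_carrier[OF l, simplified] P_inj[OF l, simplified]] galerkin[OF l]
      by simp
  qed (rule A_finest)
  have level: "two_level (n l) (A l) (B l) (n (l - 1)) (P l)" if l: "l \<in> {1..L}" for l
    using A_spd[of l] B_spd[OF l] P_carrier[OF l] P_inj[OF l] l by unfold_locales auto
  have A_coarse: "two_level.Ac (A l) (P l) = A (l - 1)" if l: "l \<in> {1..L}" for l
    using galerkin[OF l] two_level.Ac_def[OF level[OF l]] by simp
  have G: "G l = poly_mat (cheb4_p k) (B l * A l)" if l: "l \<in> {1..L}" for l
    using A_spd[of l] l spd_carrier[OF B_spd[OF l]] smoother[OF l]
    by (intro cheb4_iteration_matrix_eq_poly_mat) auto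
  have C_nonneg: "0 \<le> C l" if l: "l \<in> {1..L}" for l
    using two_level.approx_const_nonneg[OF level[OF l]] by (simp add: A_coarse[OF l] C_def[OF l])
  have C_le: "C l / (C l + \<gamma>) \<le> \<delta>" if "l \<in> {1..L}" for l
    unfolding \<delta>_def using that by (intro Max_ge) auto
  have "\<delta> \<in> (\<lambda>l. C l / (C l + \<gamma>)) ` {1..L}"
    unfolding \<delta>_def using L by (intro Max_in) auto
  then obtain l where l: "l \<in> {1..L}" "\<delta> = C l / (C l + \<gamma>)" by blast
  then have \<delta>: "0 \<le> \<delta>" "\<delta> \<le> 1"
    using C_nonneg[OF l(1)] \<gamma> by (simp_all add: divide_le_eq)
  have M_mat: "M l \<in> carrier_mat (n l) (n l)" if "l \<le> L" for l
    using that M_carrier[of l] M_coarsest spd_mat_inverse(1)[OF A_spd[of 0]] by (cases "l = 0") auto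
  \<comment> \<open>The induction runs over \<open>I - M A\<close>, which vanishes on level \<open>0\<close>, as \<open>E\<close> is determined from level \<open>1\<close> on.\<close>
  have bound: "energy_bound (n l) (A l) \<delta> (1\<^sub>m (n l) - M l * A l)" if "l \<le> L" for l
    using that
  proof (induction l)
    case 0
    have "1\<^sub>m (n 0) - M 0 * A 0 = 0\<^sub>m (n 0) (n 0)"
      using spd_mat_inverse(3)[OF A_spd[of 0]] M_coarsest by auto
    moreover have "0\<^sub>m (n 0) (n 0) *\<^sub>v u = (0\<^sub>v (n 0) :: real vec)" if "u \<in> carrier_vec (n 0)" for u
      using that by (intro eq_vecI) auto
    ultimately show ?case
      using \<delta> form_nonneg[OF A_spd[of 0]] form_zero(1)[OF spd_carrier[OF A_spd[of 0]]]
      by (simp add: energy_bound_def)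
  next
    case (Suc l)
    then have l: "Suc l \<in> {1..L}" by simp
    have "C (Suc l) \<le> \<delta> * (C (Suc l) + \<gamma>)"
      using C_le[OF l] C_nonneg[OF l] \<gamma> by (simp add: divide_le_eq)
    then have "energy_bound (n (Suc l)) (A (Suc l)) \<delta> (poly_mat (cheb4_p k) (B (Suc l) * A (Suc l)) *
        (1\<^sub>m (n (Suc l)) - P (Suc l) * M l * (P (Suc l))\<^sup>T * A (Suc l)))"
      using two_level.energy_bound_step[OF level[OF l], of "M l" \<delta> k] Suc M_mat[of l] B_scaled[OF l] \<delta>
      by (simp add: A_coarse[OF l, simplified] C_def[OF l, simplified] \<gamma>_def)
    then show ?case
      using half_V_cycle[OF l] E_def[OF l] K_def[OF l] G[OF l] by simp
  qed
  have L': "L \<in> {1..L}" using L by simp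
  have "(op_norm_wrt (A L) (E L))\<^sup>2 \<le> \<delta>"
  proof (rule op_norm_wrt_le[OF A_finest _ _ _ \<delta>(1)])
    show "0 < n L" using dims[OF L'] by simp
    show "E L \<in> carrier_mat (n L) (n L)"
      unfolding E_def[OF L'] using M_mat[of L] spd_carrier[OF A_finest] by (intro minus_carrier_mat) auto
    show "energy_bound (n L) (A L) \<delta> (E L)"
      unfolding E_def[OF L'] by (rule bound) simp
  qed
  then show ?thesis using G by (simp add: \<delta>_def \<gamma>_def)
qed

end
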